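(* Let $G=(V,E,J)$ be a weighted graph, let $\beta\geq 0$, and for each finite set of vertices $A$ let $\tau(A)=\tau_\beta^G(A)$ denote the probability that the vertices of $A$ all belong to the same cluster of Bernoulli bond percolation on $G$ at parameter $\beta$. Then the inequality \[\tau(A)^2 \leq 4(|A|-1)^2 (2^{|A|-2}-1) \max\, \tau(A_1\cup A_2)\,\tau(A_2\cup A_3)\,\tau(A_3\cup A_1)\] holds for every finite set $A\subseteq V$ with $|A|\geq 3$, where the maximum is taken over partitions of $A$ into three non-empty subsets $A_1$, $A_2$, and $A_3$.
   Context: A weighted graph $G=(V,E,J)$ is a countable graph $(V,E)$ together with non-negative edge weights $J:E\to[0,\infty)$. In Bernoulli bond percolation on $G$ at parameter $\beta\ge0$, each edge $e\in E$ is open independently with probability $1-e^{-\beta J(e)}$ and closed otherwise; clusters are the connected components of the subgraph of open edges. *)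

theory Defs
  imports "HOL-Probability.Probability"
begin

locale weighted_graph =
  fixes V :: "'a set" and E :: "'a set set" and J :: "'a set \<Rightarrow> real"
  assumes countable_V: "countable V"
    and edges: "e \<in> E \<Longrightarrow> e \<subseteq> V \<and> card e = 2"
    and weights_nonneg: "e \<in> E \<Longrightarrow> 0 \<le> J e"

(* A configuration maps each edge to True if it is open and to False if it is closed. *)
definition bond_percolation :: "'a set set \<Rightarrow> ('a set \<Rightarrow> real) \<Rightarrow> real \<Rightarrow> ('a set \<Rightarrow> bool) measure" where
  "bond_percolation E J \<beta> =
     (\<Pi>\<^sub>M e\<in>E. measure_pmf (bernoulli_pmf (1 - exp (- \<beta> * J e))))"

definition open_adj :: "'a set set \<Rightarrow> ('a set \<Rightarrow> bool) \<Rightarrow> ('a \<times> 'a) set" where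
  "open_adj E \<omega> = {(u, v). {u, v} \<in> E \<and> \<omega> {u, v}}"

definition cluster :: "'a set \<Rightarrow> 'a set set \<Rightarrow> ('a set \<Rightarrow> bool) \<Rightarrow> 'a \<Rightarrow> 'a set" where
  "cluster V E \<omega> v = {u \<in> V. (v, u) \<in> (open_adj E \<omega>)\<^sup>*}"

definition clusters :: "'a set \<Rightarrow> 'a set set \<Rightarrow> ('a set \<Rightarrow> bool) \<Rightarrow> 'a set set" where
  "clusters V E \<omega> = cluster V E \<omega> ` V"

definition tau :: "'a set \<Rightarrow> 'a set set \<Rightarrow> ('a set \<Rightarrow> real) \<Rightarrow> real \<Rightarrow> 'a set \<Rightarrow> real" where
  "tau V E J \<beta> A =
     measure (bond_percolation E J \<beta>)
       {\<omega> \<in> space (bond_percolation E J \<beta>). \<exists>C \<in> clusters V E \<omega>. A \<subseteq> C}"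

end

theory Submission imports Defs begin

text \<open>
  Fix \<open>c \<in> A\<close>, put \<open>B = A - {c}\<close> and \<open>m = |B|\<close>, and let \<open>Q\<close> be the probability that, for some partition of
  \<open>B\<close> into nonempty \<open>S\<close> and \<open>S'\<close>, the set \<open>S \<union> {c}\<close> is joined in one copy of percolation and \<open>S' \<union> {c}\<close>
  in a second, independent copy. It suffices to show \<open>\<tau>(A) \<le> \<theta> \<tau>(B) + m\<^sup>2 Q / \<theta>\<close> on finite
  graphs for all \<open>\<theta> > 0\<close>: optimising in \<open>\<theta>\<close> gives \<open>\<tau>(A)\<^sup>2 \<le> 4 m\<^sup>2 \<tau>(B) Q\<close>, and \<open>Q\<close> is at
  most a sum of \<open>2 ^ (m - 1) - 1\<close> products.

  The edges are revealed along a decision tree. Revealing an edge averages both probabilities \<open>\<tau>\<close>, and by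
  the van den Berg--Kesten argument \<open>Q\<close> dominates its average, so the bound only has to be checked at
  the leaves. Territories are grown from the points of \<open>B\<close>, but only as long as each is joined to \<open>c\<close> with
  conditional probability less than \<open>\<theta>\<close>; edges between two territories are always revealed. Suppose
  the exploration stops, and let \<open>x b\<close> be the conditional probability that \<open>c\<close> is joined to the territory of \<open>b\<close>.
  If all territories are connected to each other, then \<open>\<tau>(A) \<le> \<Sum>b. x b\<close>, \<open>\<tau>(B) = 1\<close>, and
  \<open>Q \<ge> x b * x b'\<close> for \<open>b \<noteq> b'\<close>. Otherwise a leaf of the tree that joins the connected classes of
  territories and \<open>c\<close> is a class that has an open edge to unexplored vertices, while everything
  else is joined off that class. These two events are independent, and the probability of the first is at most
  \<open>2 / \<theta>\<close> times the sum of \<open>x b\<close> over the class, because every edge not yet revealed would push \<open>x b\<close> above \<open>\<theta>\<close>.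
\<close>

section \<open>Connectivity in sets of edges\<close>

definition link :: "'a set set \<Rightarrow> ('a \<times> 'a) set" where
  "link \<eta> = {(u, v). {u, v} \<in> \<eta>}"

definition joined :: "'a set set \<Rightarrow> 'a set \<Rightarrow> bool" where
  "joined \<eta> S \<longleftrightarrow> (\<forall>x\<in>S. \<forall>y\<in>S. (x, y) \<in> (link \<eta>)\<^sup>*)"

definition hits :: "'a set set \<Rightarrow> 'a \<Rightarrow> 'a set \<Rightarrow> bool" where
  "hits \<eta> x S \<longleftrightarrow> (\<exists>s\<in>S. (x, s) \<in> (link \<eta>)\<^sup>*)"

definition avoiding :: "'a set set \<Rightarrow> 'a set \<Rightarrow> 'a set set" where
  "avoiding \<eta> S = {e \<in> \<eta>. e \<inter> S = {}}"

lemma link_mono: "\<eta> \<subseteq> \<eta>' \<Longrightarrow> link \<eta> \<subseteq> link \<eta>'"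
  by (auto simp: link_def)

lemma link_rtrancl_mono: "\<eta> \<subseteq> \<eta>' \<Longrightarrow> p \<in> (link \<eta>)\<^sup>* \<Longrightarrow> p \<in> (link \<eta>')\<^sup>*"
  using rtrancl_mono[OF link_mono] by blast

lemma link_sym: "(x, y) \<in> (link \<eta>)\<^sup>* \<Longrightarrow> (y, x) \<in> (link \<eta>)\<^sup>*"
proof -
  have "sym (link \<eta>)" by (auto simp: link_def sym_def insert_commute)
  then show "(x, y) \<in> (link \<eta>)\<^sup>* \<Longrightarrow> (y, x) \<in> (link \<eta>)\<^sup>*"
    by (meson sym_rtrancl symD)
qed

lemma link_trans: "(x, y) \<in> (link \<eta>)\<^sup>* \<Longrightarrow> (y, z) \<in> (link \<eta>)\<^sup>* \<Longrightarrow> (x, z) \<in> (link \<eta>)\<^sup>*"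
  by (rule rtrancl_trans)

lemma link_edge: "{x, y} \<in> \<eta> \<Longrightarrow> (x, y) \<in> (link \<eta>)\<^sup>*"
  by (auto simp: link_def)

lemma joined_mono: "\<eta> \<subseteq> \<eta>' \<Longrightarrow> S' \<subseteq> S \<Longrightarrow> joined \<eta> S \<Longrightarrow> joined \<eta>' S'"
  unfolding joined_def using link_rtrancl_mono by blast

lemma joinedI: "(\<And>x. x \<in> S \<Longrightarrow> (r, x) \<in> (link \<eta>)\<^sup>*) \<Longrightarrow> joined \<eta> S"
  unfolding joined_def using link_sym link_trans by meson

lemma hits_mono: "\<eta> \<subseteq> \<eta>' \<Longrightarrow> S \<subseteq> S' \<Longrightarrow> hits \<eta> x S \<Longrightarrow> hits \<eta>' x S'"
  unfolding hits_def using link_rtrancl_mono by blast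

text \<open>Cut the path at its first vertex in \<open>S\<close>: the part before it avoids
  \<open>S\<close>, and only the last edge \<open>{u, s}\<close> touches \<open>S\<close>.\<close>

lemma first_hit:
  assumes "(x, v) \<in> (link \<eta>)\<^sup>*" "v \<in> S" "x \<notin> S"
  shows "\<exists>u s. (x, u) \<in> (link (avoiding \<eta> S))\<^sup>* \<and> u \<notin> S \<and> {u, s} \<in> \<eta> \<and> s \<in> S"
  using assms
proof (induction rule: converse_rtrancl_induct)
  case base
  then show ?case by simp
next
  case (step x y)
  have e: "{x, y} \<in> \<eta>" using step.hyps by (simp add: link_def)
  show ?case
  proof (cases "y \<in> S")
    case True
    then show ?thesis using e step.prems by blast
  next
    case False
    then obtain u s where us: "(y, u) \<in> (link (avoiding \<eta> S))\<^sup>*" "u \<notin> S" "{u, s} \<in> \<eta>" "s \<in> S"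
      using step by blast
    have "{x, y} \<in> avoiding \<eta> S" using e False step.prems by (simp add: avoiding_def)
    then have "(x, u) \<in> (link (avoiding \<eta> S))\<^sup>*" using us(1) link_edge link_trans by meson
    then show ?thesis using us by blast
  qed
qed

text \<open>\<open>link\<close> sees only members of the form \<open>{u, v}\<close>, so inclusion is
  required for these alone. The members of \<open>\<eta>\<close> may be sets of any size; the empty
  set, for instance, belongs to every \<open>avoiding\<close> set of a family containing it.\<close>

lemma link_rtrancl_mono_pairs:
  "(\<And>u v. {u, v} \<in> \<eta> \<Longrightarrow> {u, v} \<in> \<eta>') \<Longrightarrow> p \<in> (link \<eta>)\<^sup>* \<Longrightarrow> p \<in> (link \<eta>')\<^sup>*"
  using rtrancl_mono[of "link \<eta>" "link \<eta>'"] by (auto simp: link_def)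

lemma avoiding_rtrancl_notin: "(x, y) \<in> (link (avoiding \<eta> S))\<^sup>* \<Longrightarrow> x \<notin> S \<Longrightarrow> y \<notin> S"
  by (induction rule: rtrancl_induct) (auto simp: link_def avoiding_def)

lemma avoiding_rtrancl_if_not_hits:
  "(x, y) \<in> (link \<eta>)\<^sup>* \<Longrightarrow> \<not> hits \<eta> x S \<Longrightarrow> (x, y) \<in> (link (avoiding \<eta> S))\<^sup>*"
proof (induction rule: rtrancl_induct)
  case (step y z)
  have "y \<notin> S" "z \<notin> S" using step by (auto simp: hits_def intro: rtrancl_into_rtrancl)
  then have "(y, z) \<in> link (avoiding \<eta> S)" using step.hyps(2) by (auto simp: link_def avoiding_def)
  then show ?case using step by (meson rtrancl_into_rtrancl)
qed simp

text \<open>A path has finitely many edges, so it lies in some \<open>\<eta> n\<close>; the finitely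
  many pairs of points of \<open>A\<close> then share an index.\<close>

lemma joined_incseq:
  assumes "incseq \<eta>" "finite A" "joined (\<Union>n. \<eta> n) A"
  shows "\<exists>n. joined (\<eta> n) A"
proof -
  have mono: "\<eta> m \<subseteq> \<eta> n" if "m \<le> n" for m n using assms(1) that by (simp add: incseq_def)
  have path: "\<exists>n. (x, y) \<in> (link (\<eta> n))\<^sup>*" if "(x, y) \<in> (link (\<Union>n. \<eta> n))\<^sup>*" for x y
    using that
  proof (induction rule: rtrancl_induct)
    case (step y z)
    then obtain n m where n: "(x, y) \<in> (link (\<eta> n))\<^sup>*" "{y, z} \<in> \<eta> m"
      by (auto simp: link_def)
    have "(x, y) \<in> (link (\<eta> (max n m)))\<^sup>*" by (rule link_rtrancl_mono[OF mono n(1)]) simp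
    moreover have "{y, z} \<in> \<eta> (max n m)" using n(2) mono[of m "max n m"] by auto
    ultimately have "(x, z) \<in> (link (\<eta> (max n m)))\<^sup>*" by (rule link_trans[OF _ link_edge])
    then show ?case ..
  qed simp
  define N where "N x y = (SOME n. (x, y) \<in> (link (\<eta> n))\<^sup>*)" for x y
  have N: "(x, y) \<in> (link (\<eta> (N x y)))\<^sup>*" if "x \<in> A" "y \<in> A" for x y
    unfolding N_def by (rule someI_ex) (use path assms(3) that in \<open>auto simp: joined_def\<close>)
  \<comment> \<open>The sum of all \<open>N x y\<close> is an index at least as large as each of
    them.\<close>
  have "joined (\<eta> (\<Sum>x\<in>A. \<Sum>y\<in>A. N x y)) A"
    unfolding joined_def
  proof (intro ballI)
    fix x y assume xy: "x \<in> A" "y \<in> A"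
    have "N x y \<le> (\<Sum>y\<in>A. N x y)" using assms(2) xy by (intro member_le_sum) auto
    also have "\<dots> \<le> (\<Sum>x\<in>A. \<Sum>y\<in>A. N x y)"
      using assms(2) xy by (intro member_le_sum[of x A "\<lambda>x. \<Sum>y\<in>A. N x y"]) auto
    finally show "(x, y) \<in> (link (\<eta> (\<Sum>x\<in>A. \<Sum>y\<in>A. N x y)))\<^sup>*"
      by (rule link_rtrancl_mono[OF mono N[OF xy]])
  qed
  then show ?thesis by blast
qed

section \<open>Bernoulli percolation on finitely many edges\<close>

text \<open>A configuration is identified with its set \<open>\<omega> \<subseteq> U\<close> of open edges.\<close>

definition expc :: "('e \<Rightarrow> real) \<Rightarrow> 'e set \<Rightarrow> ('e set \<Rightarrow> real) \<Rightarrow> real" where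
  "expc p U f = (\<Sum>\<omega>\<in>Pow U. (\<Prod>e\<in>U. if e \<in> \<omega> then p e else 1 - p e) * f \<omega>)"

lemma expc_empty [simp]: "expc p {} f = f {}"
  by (simp add: expc_def)

lemma expc_insert:
  assumes "finite U" "e \<notin> U"
  shows "expc p (insert e U) f = p e * expc p U (\<lambda>\<omega>. f (insert e \<omega>)) + (1 - p e) * expc p U f"
proof -
  have inj: "inj_on (insert e) (Pow U)" using assms(2) by (auto simp: inj_on_def)
  have dis: "Pow U \<inter> insert e ` Pow U = {}" using assms(2) by auto
  let ?w = "\<lambda>U \<omega>. \<Prod>e\<in>U. if e \<in> \<omega> then p e else 1 - p e"
  have w1: "?w (insert e U) \<omega> = (1 - p e) * ?w U \<omega>" if "\<omega> \<in> Pow U" for \<omega>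
    using assms that by (subst prod.insert) auto
  have w2: "?w (insert e U) (insert e \<omega>) = p e * ?w U \<omega>" if "\<omega> \<in> Pow U" for \<omega>
  proof -
    have "?w U (insert e \<omega>) = ?w U \<omega>" using assms(2) by (intro prod.cong) auto
    then show ?thesis using assms by (subst prod.insert) auto
  qed
  have "expc p (insert e U) f = (\<Sum>\<omega>\<in>Pow U. ?w (insert e U) \<omega> * f \<omega>)
      + (\<Sum>\<omega>\<in>insert e ` Pow U. ?w (insert e U) \<omega> * f \<omega>)"
    unfolding expc_def Pow_insert using assms dis by (intro sum.union_disjoint) auto
  also have "(\<Sum>\<omega>\<in>insert e ` Pow U. ?w (insert e U) \<omega> * f \<omega>)
      = (\<Sum>\<omega>\<in>Pow U. ?w (insert e U) (insert e \<omega>) * f (insert e \<omega>))"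
    by (rule sum.reindex_cong[OF inj]) auto
  also have "\<dots> = p e * expc p U (\<lambda>\<omega>. f (insert e \<omega>))"
    unfolding expc_def sum_distrib_left by (intro sum.cong refl, subst w2) (simp_all add: mult.assoc)
  also have "(\<Sum>\<omega>\<in>Pow U. ?w (insert e U) \<omega> * f \<omega>) = (1 - p e) * expc p U f"
    unfolding expc_def sum_distrib_left by (intro sum.cong refl, subst w1) (simp_all add: mult.assoc)
  finally show ?thesis by simp
qed

lemma expc_cong: "(\<And>\<omega>. \<omega> \<subseteq> U \<Longrightarrow> f \<omega> = g \<omega>) \<Longrightarrow> expc p U f = expc p U g"
  by (auto simp: expc_def intro!: sum.cong)

lemma expc_add: "expc p U (\<lambda>\<omega>. f \<omega> + g \<omega>) = expc p U f + expc p U g"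
  by (simp add: expc_def distrib_left sum.distrib)

lemma expc_cmult: "expc p U (\<lambda>\<omega>. k * f \<omega>) = k * expc p U f"
  by (simp add: expc_def sum_distrib_left mult_ac)

lemma expc_multc: "expc p U (\<lambda>\<omega>. f \<omega> * k) = expc p U f * k"
  using expc_cmult[of p U k f] by (simp add: mult.commute)

lemma expc_sum: "expc p U (\<lambda>\<omega>. \<Sum>i\<in>I. f i \<omega>) = (\<Sum>i\<in>I. expc p U (f i))"
  unfolding expc_def sum_distrib_left by (rule sum.swap)

lemma expc_const: "finite U \<Longrightarrow> expc p U (\<lambda>_. k) = k"
  by (induction U rule: finite_induct) (simp_all add: expc_insert algebra_simps)

text \<open>Fubini for two independent blocks of edges.\<close>

lemma expc_split:
  assumes "finite D" "finite W" "D \<inter> W = {}"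
  shows "expc p (D \<union> W) f = expc p D (\<lambda>\<omega>1. expc p W (\<lambda>\<omega>2. f (\<omega>1 \<union> \<omega>2)))"
  using assms(1,3)
proof (induction D arbitrary: f rule: finite_induct)
  case empty
  then show ?case by simp
next
  case (insert e D)
  then show ?case using assms(2) by (simp add: expc_insert)
qed

locale edge_probabilities =
  fixes p :: "'e \<Rightarrow> real"
  assumes p_ge: "0 \<le> p e" and p_le: "p e \<le> 1"
begin

lemma expc_mono:
  assumes "\<And>\<omega>. \<omega> \<subseteq> U \<Longrightarrow> f \<omega> \<le> g \<omega>"
  shows "expc p U f \<le> expc p U g"
  unfolding expc_def using assms p_ge p_le
  by (intro sum_mono mult_left_mono prod_nonneg) auto

lemma expc_nonneg:
  assumes "\<And>\<omega>. \<omega> \<subseteq> U \<Longrightarrow> 0 \<le> f \<omega>"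
  shows "0 \<le> expc p U f"
  unfolding expc_def using assms p_ge p_le
  by (intro sum_nonneg mult_nonneg_nonneg prod_nonneg) auto

definition prb :: "'e set \<Rightarrow> ('e set \<Rightarrow> bool) \<Rightarrow> real" where
  "prb U P = expc p U (\<lambda>\<omega>. of_bool (P \<omega>))"

lemma prb_nonneg: "0 \<le> prb U P"
  unfolding prb_def by (rule expc_nonneg) simp

lemma prb_le_1: "finite U \<Longrightarrow> prb U P \<le> 1"
  using expc_mono[of U "\<lambda>\<omega>. of_bool (P \<omega>)" "\<lambda>_. 1"] by (simp add: prb_def expc_const)

lemma prb_mono: "(\<And>\<omega>. \<omega> \<subseteq> U \<Longrightarrow> P \<omega> \<Longrightarrow> R \<omega>) \<Longrightarrow> prb U P \<le> prb U R"
  unfolding prb_def by (rule expc_mono) auto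

lemma prb_cong: "(\<And>\<omega>. \<omega> \<subseteq> U \<Longrightarrow> P \<omega> = R \<omega>) \<Longrightarrow> prb U P = prb U R"
  unfolding prb_def by (rule expc_cong) auto

lemma prb_True: "finite U \<Longrightarrow> (\<And>\<omega>. \<omega> \<subseteq> U \<Longrightarrow> P \<omega>) \<Longrightarrow> prb U P = 1"
  using prb_cong[of U P "\<lambda>_. True"] by (simp add: prb_def expc_const)

lemma prb_insert: "finite U \<Longrightarrow> e \<notin> U \<Longrightarrow>
    prb (insert e U) P = p e * prb U (\<lambda>\<omega>. P (insert e \<omega>)) + (1 - p e) * prb U P"
  unfolding prb_def by (rule expc_insert)

lemma prb_union_bound:
  assumes "finite I" "\<And>\<omega>. \<omega> \<subseteq> U \<Longrightarrow> P \<omega> \<Longrightarrow> \<exists>i\<in>I. R i \<omega>"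
  shows "prb U P \<le> (\<Sum>i\<in>I. prb U (R i))"
proof -
  have "prb U P \<le> expc p U (\<lambda>\<omega>. \<Sum>i\<in>I. of_bool (R i \<omega>))"
    unfolding prb_def
  proof (rule expc_mono)
    fix \<omega> assume w: "\<omega> \<subseteq> U"
    show "of_bool (P \<omega>) \<le> (\<Sum>i\<in>I. of_bool (R i \<omega>) :: real)"
    proof (cases "P \<omega>")
      case True
      then obtain i where "i \<in> I" "R i \<omega>" using assms(2) w by blast
      then have "(1::real) = of_bool (R i \<omega>)" by simp
      also have "\<dots> \<le> (\<Sum>i\<in>I. of_bool (R i \<omega>))"
        using assms(1) \<open>i \<in> I\<close> by (intro member_le_sum) auto
      finally show ?thesis using True by simp
    qed (simp add: sum_nonneg)
  qed
  then show ?thesis by (simp add: expc_sum prb_def)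
qed

lemma prb_local:
  assumes "finite U" "D \<subseteq> U" "\<And>\<omega>. \<omega> \<subseteq> U \<Longrightarrow> P \<omega> = P (\<omega> - D)"
  shows "prb U P = prb (U - D) P"
proof -
  have f: "finite D" "finite (U - D)" using assms finite_subset by auto
  have "prb U P = expc p D (\<lambda>\<omega>1. expc p (U - D) (\<lambda>\<omega>2. of_bool (P (\<omega>1 \<union> \<omega>2))))"
    unfolding prb_def using expc_split[OF f, of p] assms(2) by (simp add: Un_absorb1)
  also have "\<dots> = expc p D (\<lambda>\<omega>1. expc p (U - D) (\<lambda>\<omega>2. of_bool (P \<omega>2)))"
  proof (intro expc_cong)
    fix \<omega>1 \<omega>2 assume w: "\<omega>1 \<subseteq> D" "\<omega>2 \<subseteq> U - D"
    have "\<omega>1 \<union> \<omega>2 - D = \<omega>2 - D" using w by auto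
    then have "P (\<omega>1 \<union> \<omega>2) = P \<omega>2" using w assms(2) assms(3)[of "\<omega>1 \<union> \<omega>2"] assms(3)[of \<omega>2] by auto
    then show "of_bool (P (\<omega>1 \<union> \<omega>2)) = (of_bool (P \<omega>2) :: real)" by simp
  qed
  also have "\<dots> = prb (U - D) P" using f by (simp add: expc_const prb_def)
  finally show ?thesis .
qed

lemma prb_indep:
  assumes "finite U" "D \<subseteq> U"
    and "\<And>\<omega>. \<omega> \<subseteq> U \<Longrightarrow> P \<omega> = P (\<omega> \<inter> D)" and "\<And>\<omega>. \<omega> \<subseteq> U \<Longrightarrow> R \<omega> = R (\<omega> - D)"
  shows "prb U (\<lambda>\<omega>. P \<omega> \<and> R \<omega>) = prb D P * prb U R"
proof -
  have f: "finite D" "finite (U - D)" using assms finite_subset by auto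
  have "prb U (\<lambda>\<omega>. P \<omega> \<and> R \<omega>)
      = expc p D (\<lambda>\<omega>1. expc p (U - D) (\<lambda>\<omega>2. of_bool (P (\<omega>1 \<union> \<omega>2) \<and> R (\<omega>1 \<union> \<omega>2))))"
    unfolding prb_def using expc_split[OF f, of p] assms(2) by (simp add: Un_absorb1)
  also have "\<dots> = expc p D (\<lambda>\<omega>1. expc p (U - D) (\<lambda>\<omega>2. of_bool (P \<omega>1) * of_bool (R \<omega>2)))"
  proof (intro expc_cong)
    fix \<omega>1 \<omega>2 assume w: "\<omega>1 \<subseteq> D" "\<omega>2 \<subseteq> U - D"
    have "\<omega>1 \<union> \<omega>2 - D = \<omega>2" "(\<omega>1 \<union> \<omega>2) \<inter> D = \<omega>1" using w by auto
    moreover have "\<omega>1 \<union> \<omega>2 \<subseteq> U" using w assms(2) by auto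
    ultimately have "R (\<omega>1 \<union> \<omega>2) = R \<omega>2" "P (\<omega>1 \<union> \<omega>2) = P \<omega>1"
      using assms(3,4)[of "\<omega>1 \<union> \<omega>2"] by auto
    then show "of_bool (P (\<omega>1 \<union> \<omega>2) \<and> R (\<omega>1 \<union> \<omega>2)) = (of_bool (P \<omega>1) * of_bool (R \<omega>2) :: real)"
      by simp
  qed
  also have "\<dots> = prb D P * prb (U - D) R" by (simp add: expc_cmult expc_multc prb_def)
  finally show ?thesis using prb_local[of U D R, OF assms(1,2,4)] by simp
qed

text \<open>Removing \<open>D\<close> amounts to declaring its edges closed, which cannot help an
  increasing event.\<close>

lemma prb_diff_le:
  assumes "finite U" "D \<subseteq> U" "\<And>\<omega> \<omega>'. \<omega> \<subseteq> \<omega>' \<Longrightarrow> P \<omega> \<Longrightarrow> P \<omega>'"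
  shows "prb (U - D) P \<le> prb U P"
proof -
  have "prb (U - D) P = prb (U - D) (\<lambda>\<omega>. P (\<omega> - D))"
  proof (rule prb_cong)
    fix \<omega> assume "\<omega> \<subseteq> U - D"
    then have "\<omega> - D = \<omega>" by auto
    then show "P \<omega> = P (\<omega> - D)" by simp
  qed
  also have "\<dots> = prb U (\<lambda>\<omega>. P (\<omega> - D))"
    by (rule prb_local[symmetric]) (use assms in auto)
  also have "\<dots> \<le> prb U P" by (rule prb_mono) (use assms(3) in blast)
  finally show ?thesis .
qed

end

section \<open>Two elementary inequalities\<close>

lemma sum_le_of_small_products:
  fixes x :: "'b \<Rightarrow> real"
  assumes "finite B" "B \<noteq> {}" "0 < \<theta>"
    and x: "\<And>b. b \<in> B \<Longrightarrow> 0 \<le> x b \<and> x b \<le> \<theta>"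
    and prod: "\<And>b b'. b \<in> B \<Longrightarrow> b' \<in> B \<Longrightarrow> b \<noteq> b' \<Longrightarrow> x b * x b' \<le> q"
    and "0 \<le> q"
  shows "(\<Sum>b\<in>B. x b) \<le> \<theta> + (real (card B))\<^sup>2 * q / \<theta>"
proof -
  let ?m = "real (card B)"
  have m: "1 \<le> ?m" using assms(1,2) by (metis One_nat_def Suc_leI card_gt_0_iff of_nat_1 of_nat_mono)
  have "Max (x ` B) \<in> x ` B" using assms(1,2) by (intro Max_in) auto
  then obtain b1 where "b1 \<in> B" "x b1 = Max (x ` B)" by auto
  then have b1: "b1 \<in> B" "\<And>b. b \<in> B \<Longrightarrow> x b \<le> x b1" using assms(1) by auto
  show ?thesis
  \<comment> \<open>Here \<open>b1\<close> maximises \<open>x\<close>. Either \<open>?m\<close>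
    times the maximum is at most \<open>\<theta>\<close>, or \<open>x b1 > \<theta> / ?m\<close>,
    and the bound on products forces every other \<open>x b\<close> to be at most
    \<open>?m * q / \<theta>\<close>.\<close>
  proof (cases "?m * x b1 \<le> \<theta>")
    case True
    have "(\<Sum>b\<in>B. x b) \<le> ?m * x b1" using sum_bounded_above[of B x "x b1"] b1 by simp
    moreover have "0 \<le> ?m\<^sup>2 * q / \<theta>" using assms by simp
    ultimately show ?thesis using True by linarith
  next
    case False
    have "x b \<le> ?m * q / \<theta>" if "b \<in> B - {b1}" for b
    proof -
      have "\<theta> * x b \<le> (?m * x b1) * x b" using False x[of b] that by (intro mult_right_mono) auto
      also have "\<dots> = ?m * (x b * x b1)" by simp
      also have "\<dots> \<le> ?m * q" using prod[of b b1] that b1 by (intro mult_left_mono) auto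
      finally show ?thesis using assms(3) by (simp add: field_simps)
    qed
    then have "(\<Sum>b\<in>B - {b1}. x b) \<le> real (card (B - {b1})) * (?m * q / \<theta>)"
      using sum_bounded_above[of "B - {b1}" x "?m * q / \<theta>"] by simp
    also have "\<dots> \<le> ?m * (?m * q / \<theta>)"
      using assms by (intro mult_right_mono) (auto intro: card_mono)
    also have "\<dots> = ?m\<^sup>2 * q / \<theta>" by (simp add: power2_eq_square)
    finally show ?thesis using x[OF b1(1)] b1(1) assms(1) by (simp add: sum.remove[of B b1])
  qed
qed

lemma square_le_if_le_weighted_sum:
  fixes x a b :: real
  assumes le: "\<And>\<theta>. 0 < \<theta> \<Longrightarrow> x \<le> \<theta> * a + b / \<theta>" and "0 \<le> x" "x \<le> a" "0 \<le> b"
  shows "x\<^sup>2 \<le> 4 * (a * b)"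
proof (cases "x = 0")
  case True
  then show ?thesis using assms by simp
next
  case False
  then have pos: "0 < x" "0 < a" using assms by auto
  \<comment> \<open>This \<open>\<theta>\<close> makes the first term \<open>x / 2\<close>. It
    avoids the square root of the optimal choice and gives the same constant 4.\<close>
  have "x \<le> x / 2 + b / (x / (2 * a))" using le[of "x / (2 * a)"] pos by simp
  also have "b / (x / (2 * a)) = 2 * (a * b) / x" by simp
  finally have "x / 2 \<le> 2 * (a * b) / x" by linarith
  then show ?thesis using pos by (simp add: field_simps power2_eq_square)
qed

section \<open>Disjoint occurrence in two copies\<close>

locale two_copies = edge_probabilities p for p :: "'a set \<Rightarrow> real" +
  fixes c r :: 'a and B :: "'a set"
  assumes finite_B: "finite B" and c_notin: "c \<notin> B" and r_in: "r \<in> B" and card_B: "2 \<le> card B"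
begin

text \<open>Fixing the side that contains \<open>r\<close> lists each unordered split of
  \<open>B\<close> once, whence \<open>2 ^ (card B - 1) - 1\<close> splits;
  \<open>S \<subset> B\<close> keeps the other side nonempty.\<close>

definition split_joined :: "'a set set \<Rightarrow> 'a set set \<Rightarrow> bool" where
  "split_joined \<eta> \<eta>' \<longleftrightarrow>
     (\<exists>S. r \<in> S \<and> S \<subset> B \<and> joined \<eta> (insert c S) \<and> joined \<eta>' (insert c (B - S)))"

text \<open>\<open>H\<close> is the set of edges already found to be open, and \<open>U\<close> the set of edges not yet revealed.
  The two copies share \<open>H\<close>, but each edge of \<open>H\<close> may be used in only one of them; the edges of \<open>U\<close>
  are independent in the two copies.\<close>

definition Q :: "'a set set \<Rightarrow> 'a set set \<Rightarrow> real" where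
  "Q U H = expc p U (\<lambda>\<omega>. prb U (\<lambda>\<omega>'. \<exists>X\<subseteq>H. split_joined (\<omega> \<union> X) (\<omega>' \<union> (H - X))))"

lemma split_joined_mono:
  "split_joined \<eta> \<eta>' \<Longrightarrow> \<eta> \<subseteq> \<xi> \<Longrightarrow> \<eta>' \<subseteq> \<xi>' \<Longrightarrow> split_joined \<xi> \<xi>'"
  unfolding split_joined_def using joined_mono by (metis order_refl)

lemma Q_nonneg: "0 \<le> Q U H"
  unfolding Q_def by (intro expc_nonneg prb_nonneg)

text \<open>The van den Berg--Kesten step: splitting a shared edge into two independent ones does not
  decrease the probability of disjoint occurrence.\<close>

lemma Q_insert:
  assumes "finite U" "e \<notin> U"
  shows "p e * Q U (insert e H) + (1 - p e) * Q U H \<le> Q (insert e U) H"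
proof -
  define d where "d H \<omega> \<omega>' = (of_bool (\<exists>X\<subseteq>H. split_joined (\<omega> \<union> X) (\<omega>' \<union> (H - X))) :: real)"
    for H \<omega> \<omega>'
  have Qd: "Q U H = expc p U (\<lambda>\<omega>. expc p U (\<lambda>\<omega>'. d H \<omega> \<omega>'))" for U H
    by (simp add: Q_def prb_def d_def)
  have d01: "d H \<omega> \<omega>' = 0 \<or> d H \<omega> \<omega>' = 1" for H \<omega> \<omega>' by (auto simp: d_def)
  have d_mono: "d H \<omega> \<omega>' \<le> d H \<xi> \<xi>'" if "\<omega> \<subseteq> \<xi>" "\<omega>' \<subseteq> \<xi>'" for H \<omega> \<omega>' \<xi> \<xi>'
  proof -
    have "split_joined (\<xi> \<union> X) (\<xi>' \<union> (H - X))" if "split_joined (\<omega> \<union> X) (\<omega>' \<union> (H - X))" for X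
      using split_joined_mono[OF that, of "\<xi> \<union> X" "\<xi>' \<union> (H - X)"] \<open>\<omega> \<subseteq> \<xi>\<close> \<open>\<omega>' \<subseteq> \<xi>'\<close> by blast
    then show ?thesis by (auto simp: d_def)
  qed
  \<comment> \<open>A witness \<open>X\<close> for \<open>insert e H\<close> gives \<open>e\<close>
    to one copy only, so it suffices that \<open>e\<close> is open in that copy.\<close>
  have d_ins: "d (insert e H) \<omega> \<omega>' \<le> max (d H (insert e \<omega>) \<omega>') (d H \<omega> (insert e \<omega>'))" for \<omega> \<omega>'
  proof (cases "d (insert e H) \<omega> \<omega>' = 1")
    case True
    then obtain X where X: "X \<subseteq> insert e H" "split_joined (\<omega> \<union> X) (\<omega>' \<union> (insert e H - X))"
      by (auto simp: d_def split: if_splits)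
    show ?thesis
    proof (cases "e \<in> X")
      case True
      have "split_joined (insert e \<omega> \<union> (X - {e})) (\<omega>' \<union> (H - (X - {e})))"
        by (rule split_joined_mono[OF X(2)]) (use True in auto)
      then have "d H (insert e \<omega>) \<omega>' = 1" using X(1) unfolding d_def by (auto intro!: exI[of _ "X - {e}"])
      then show ?thesis using d01[of "insert e H" \<omega> \<omega>'] by linarith
    next
      case False
      have "split_joined (\<omega> \<union> X) (insert e \<omega>' \<union> (H - X))"
        by (rule split_joined_mono[OF X(2)]) auto
      then have "d H \<omega> (insert e \<omega>') = 1" using X(1) False unfolding d_def by auto
      then show ?thesis using d01[of "insert e H" \<omega> \<omega>'] by linarith
    qed
  next
    case False
    then show ?thesis using d01 by (metis max.coboundedI1 order_refl zero_le_one)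
  qed
  let ?p = "p e" and ?q = "1 - p e"
  have point: "?p * d (insert e H) \<omega> \<omega>' + ?q * d H \<omega> \<omega>'
      \<le> ?p * (?p * d H (insert e \<omega>) (insert e \<omega>') + ?q * d H (insert e \<omega>) \<omega>')
        + ?q * (?p * d H \<omega> (insert e \<omega>') + ?q * d H \<omega> \<omega>')" for \<omega> \<omega>'
  proof -
    let ?a = "d H \<omega> \<omega>'" and ?b = "d H (insert e \<omega>) \<omega>'" and ?b' = "d H \<omega> (insert e \<omega>')"
      and ?f = "d H (insert e \<omega>) (insert e \<omega>')" and ?g = "d (insert e H) \<omega> \<omega>'"
    have le: "?a \<le> ?b" "?a \<le> ?b'" "?b \<le> ?f" "?b' \<le> ?f" by (intro d_mono; blast)+
    have pq: "0 \<le> ?p" "0 \<le> ?q" using p_ge p_le by (auto simp: algebra_simps)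
    have "?p * ?p * max ?b ?b' \<le> ?p * ?p * ?f" using le pq by (intro mult_left_mono) auto
    \<comment> \<open>\<open>?b + ?b'\<close> is the sum of their maximum and their minimum, and the
      minimum is at least \<open>?a\<close>.\<close>
    moreover have "?p * ?q * (max ?b ?b' + ?a) \<le> ?p * ?q * (?b + ?b')"
      using le pq by (intro mult_left_mono) auto
    moreover have "?p * ?g \<le> ?p * max ?b ?b'" using d_ins pq by (intro mult_left_mono) auto
    moreover have "?p * max ?b ?b' + ?q * ?a = ?p * ?p * max ?b ?b' + ?p * ?q * (max ?b ?b' + ?a) + ?q * ?q * ?a"
      by (simp add: algebra_simps)
    ultimately have "?p * ?g + ?q * ?a \<le> ?p * ?p * ?f + ?p * ?q * (?b + ?b') + ?q * ?q * ?a" by linarith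
    then show ?thesis by (simp add: algebra_simps)
  qed
  have "?p * Q U (insert e H) + ?q * Q U H
      = expc p U (\<lambda>\<omega>. expc p U (\<lambda>\<omega>'. ?p * d (insert e H) \<omega> \<omega>' + ?q * d H \<omega> \<omega>'))"
    by (simp add: Qd expc_add expc_cmult)
  also have "\<dots> \<le> expc p U (\<lambda>\<omega>. expc p U (\<lambda>\<omega>'.
        ?p * (?p * d H (insert e \<omega>) (insert e \<omega>') + ?q * d H (insert e \<omega>) \<omega>')
        + ?q * (?p * d H \<omega> (insert e \<omega>') + ?q * d H \<omega> \<omega>')))"
    by (intro expc_mono point)
  also have "\<dots> = Q (insert e U) H"
    using assms by (simp add: Qd expc_add expc_cmult expc_insert) (simp add: algebra_simps)
  finally show ?thesis .
qed

text \<open>The copies are independent, so the product is the probability of \<open>F\<close> in one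
  and \<open>G\<close> in the other; the revealed edges \<open>X\<close> are handed to the first
  event and \<open>H - X\<close> to the second.\<close>

lemma prb_mult_le_Q:
  assumes "finite U" "X \<subseteq> H" "S \<subset> B" "S \<noteq> {}"
    and F: "\<And>\<omega>. \<omega> \<subseteq> U \<Longrightarrow> F \<omega> \<Longrightarrow> joined (\<omega> \<union> X) (insert c S)"
    and G: "\<And>\<omega>. \<omega> \<subseteq> U \<Longrightarrow> G \<omega> \<Longrightarrow> joined (\<omega> \<union> (H - X)) (insert c (B - S))"
  shows "prb U F * prb U G \<le> Q U H"
proof -
  have *: "prb U F * prb U G \<le> Q U H"
    if "\<And>\<omega> \<omega>'. \<omega> \<subseteq> U \<Longrightarrow> \<omega>' \<subseteq> U \<Longrightarrow> F \<omega> \<Longrightarrow> G \<omega>' \<Longrightarrow>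
          \<exists>X\<subseteq>H. split_joined (\<omega> \<union> X) (\<omega>' \<union> (H - X))" for F G
  proof -
    have "prb U F * prb U G = expc p U (\<lambda>\<omega>. expc p U (\<lambda>\<omega>'. of_bool (F \<omega>) * of_bool (G \<omega>')))"
      by (simp add: prb_def expc_cmult expc_multc)
    also have "\<dots> \<le> Q U H"
      unfolding Q_def prb_def by (intro expc_mono) (use that in auto)
    finally show ?thesis .
  qed
  show ?thesis
  proof (cases "r \<in> S")
    case True
    show ?thesis
    proof (rule *)
      fix \<omega> \<omega>' assume w: "\<omega> \<subseteq> U" "\<omega>' \<subseteq> U" "F \<omega>" "G \<omega>'"
      have "split_joined (\<omega> \<union> X) (\<omega>' \<union> (H - X))"
        unfolding split_joined_def using F[OF w(1,3)] G[OF w(2,4)] True assms(3)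
        by (intro exI[of _ S]) auto
      then show "\<exists>X\<subseteq>H. split_joined (\<omega> \<union> X) (\<omega>' \<union> (H - X))" using assms(2) by (intro exI[of _ X] conjI)
    qed
  next
    case False
    \<comment> \<open>\<open>split_joined\<close> wants \<open>r\<close> on the side of the first
      copy, so the copies exchange roles here, and with them \<open>S\<close> and
      \<open>B - S\<close>, \<open>X\<close> and \<open>H - X\<close>.\<close>
    have SS: "B - (B - S) = S" using assms(3) by auto
    have "prb U G * prb U F \<le> Q U H"
    proof (rule *)
      fix \<omega> \<omega>' assume w: "\<omega> \<subseteq> U" "\<omega>' \<subseteq> U" "G \<omega>" "F \<omega>'"
      have "H - (H - X) = X" using assms(2) by auto
      then have "split_joined (\<omega> \<union> (H - X)) (\<omega>' \<union> (H - (H - X)))"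
        unfolding split_joined_def using F[OF w(2,4)] G[OF w(1,3)] False r_in assms(3,4) SS
        by (intro exI[of _ "B - S"]) auto
      then show "\<exists>X\<subseteq>H. split_joined (\<omega> \<union> X) (\<omega>' \<union> (H - X))"
        by (intro exI[of _ "H - X"] conjI) auto
    qed
    then show ?thesis by (simp add: mult.commute)
  qed
qed

section \<open>Exploration from the terminals\<close>

definition hit :: "'a set set \<Rightarrow> 'a set \<Rightarrow> real" where
  "hit U S = prb U (\<lambda>\<omega>. hits \<omega> c S)"

text \<open>\<open>T b\<close> is the territory explored so far from the terminal \<open>b\<close>.\<close>

definition exploration :: "'a set set \<Rightarrow> ('a \<Rightarrow> 'a set) \<Rightarrow> bool" where
  "exploration H T \<longleftrightarrow> (\<forall>b\<in>B. b \<in> T b \<and> joined {e \<in> H. e \<subseteq> T b} (T b))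
     \<and> (\<forall>b\<in>B. \<forall>b'\<in>B. b \<noteq> b' \<longrightarrow> T b \<inter> T b' = {}) \<and> (\<forall>e\<in>H. e \<subseteq> (\<Union>b\<in>B. T b))"

lemma hit_nonneg: "0 \<le> hit U S"
  unfolding hit_def by (rule prb_nonneg)

lemma hit_diff_le: "finite U \<Longrightarrow> D \<subseteq> U \<Longrightarrow> hit (U - D) S \<le> hit U S"
  unfolding hit_def by (rule prb_diff_le, assumption, assumption, rule hits_mono[OF _ order_refl])

lemma explorationD:
  assumes "exploration H T"
  shows "b \<in> B \<Longrightarrow> b \<in> T b"
    and "b \<in> B \<Longrightarrow> x \<in> T b \<Longrightarrow> y \<in> T b \<Longrightarrow> (x, y) \<in> (link {e \<in> H. e \<subseteq> T b})\<^sup>*"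
    and "b \<in> B \<Longrightarrow> b' \<in> B \<Longrightarrow> x \<in> T b \<Longrightarrow> x \<in> T b' \<Longrightarrow> b = b'"
    and "{u, v} \<in> H \<Longrightarrow> \<exists>b\<in>B. u \<in> T b"
proof -
  note ex = assms[unfolded exploration_def]
  show "b \<in> B \<Longrightarrow> b \<in> T b"
    and "b \<in> B \<Longrightarrow> x \<in> T b \<Longrightarrow> y \<in> T b \<Longrightarrow> (x, y) \<in> (link {e \<in> H. e \<subseteq> T b})\<^sup>*"
    using ex by (simp_all add: joined_def)
  show "b \<in> B \<Longrightarrow> b' \<in> B \<Longrightarrow> x \<in> T b \<Longrightarrow> x \<in> T b' \<Longrightarrow> b = b'"
    using conjunct1[OF conjunct2[OF ex]] IntI[of x "T b" "T b'"] by fastforce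
  show "{u, v} \<in> H \<Longrightarrow> \<exists>b\<in>B. u \<in> T b"
    using bspec[OF conjunct2[OF conjunct2[OF ex]], of "{u, v}"] by auto
qed

text \<open>The first copy gets the terminals that \<open>b'\<close> cannot reach without touching \<open>T b\<close>, since each
  of them reaches \<open>T b\<close> by edges that the second copy does not need.\<close>

lemma hit_mult_le_Q:
  assumes "finite U" and ex: "exploration H T" and "joined H B"
    and b: "b \<in> B" "b' \<in> B" "b \<noteq> b'"
  shows "hit U (T b) * hit U (T b') \<le> Q U H"
proof -
  \<comment> \<open>\<open>W\<close> is the component of \<open>b'\<close> in \<open>H\<close> off
    \<open>T b\<close>. The edges of \<open>H\<close> inside it are reserved for the second copy;
    all others form \<open>X\<close>.\<close>
  define W where "W = {v. (b', v) \<in> (link (avoiding H (T b)))\<^sup>*}"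
  define X where "X = H - {e \<in> H. e \<inter> T b = {} \<and> e \<subseteq> W}"
  have b'T: "b' \<notin> T b" using explorationD(1,3)[OF ex] b by blast
  have W_disj: "v \<notin> T b" if "v \<in> W" for v
    by (rule avoiding_rtrancl_notin[OF that[unfolded W_def mem_Collect_eq] b'T])
  have W_edge: "z \<in> W" if "{y, z} \<in> avoiding H (T b)" "y \<in> W" for y z
    using link_trans[OF _ link_edge[OF that(1)]] that(2) unfolding W_def by simp
  show ?thesis unfolding hit_def
  proof (rule prb_mult_le_Q)
    show "X \<subseteq> H" by (auto simp: X_def)
    have "b' \<in> W" by (simp add: W_def)
    then show "B - W \<subset> B" using b by auto
    have "b \<notin> W" using W_disj explorationD(1)[OF ex] b by blast
    then show "B - W \<noteq> {}" using b by auto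
  next
    fix \<omega> assume "hits \<omega> c (T b)"
    then obtain s where s: "s \<in> T b" "(c, s) \<in> (link \<omega>)\<^sup>*" by (auto simp: hits_def)
    have inT: "(x, y) \<in> (link X)\<^sup>*" if "x \<in> T b" "y \<in> T b" for x y
      by (rule link_rtrancl_mono_pairs[OF _ explorationD(2)[OF ex b(1) that]]) (auto simp: X_def)
    \<comment> \<open>\<open>W\<close> is closed under edges of \<open>H\<close> that avoid
      \<open>T b\<close>, so a path of such edges starting outside \<open>W\<close> never enters it
      and uses only \<open>X\<close>.\<close>
    have notW: "(x, u) \<in> (link X)\<^sup>* \<and> u \<notin> W" if "(x, u) \<in> (link (avoiding H (T b)))\<^sup>*" "x \<notin> W" for x u
      using that
    proof (induction rule: rtrancl_induct)
      case (step y z)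
      have e: "{y, z} \<in> avoiding H (T b)" using step.hyps by (simp add: link_def)
      then have "{y, z} \<in> X" using step by (auto simp: X_def avoiding_def)
      moreover have "z \<notin> W" using W_edge[of z y] e step by (auto simp: insert_commute)
      ultimately show ?case using link_trans[OF _ link_edge, of x y X z] step.IH step.prems by blast
    qed simp
    have x_b: "(x, b) \<in> (link X)\<^sup>*" if x: "x \<in> B" "x \<notin> W" for x
    proof (cases "x \<in> T b")
      case True
      then show ?thesis using inT explorationD(1)[OF ex b(1)] by blast
    next
      case False
      have "(x, b) \<in> (link H)\<^sup>*" using \<open>joined H B\<close> x b by (auto simp: joined_def)
      from first_hit[OF this explorationD(1)[OF ex b(1)] False] obtain u t where
        u: "(x, u) \<in> (link (avoiding H (T b)))\<^sup>*" "u \<notin> T b" "{u, t} \<in> H" "t \<in> T b" by blast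
      have "{u, t} \<in> X" using u by (auto simp: X_def)
      then show ?thesis
        using link_trans[OF link_trans[OF conjunct1[OF notW[OF u(1) x(2)]] link_edge]
            inT[OF u(4) explorationD(1)[OF ex b(1)]]] by simp
    qed
    have "(s, x) \<in> (link X)\<^sup>*" if "x \<in> B - W" for x
      using link_trans[OF inT[OF s(1) explorationD(1)[OF ex b(1)]] link_sym[OF x_b[of x]]] that by simp
    then have "(c, x) \<in> (link (\<omega> \<union> X))\<^sup>*" if "x \<in> B - W" for x
      using that link_trans[OF link_rtrancl_mono[OF Un_upper1 s(2)] link_rtrancl_mono[OF Un_upper2]] by simp
    then show "joined (\<omega> \<union> X) (insert c (B - W))" by (intro joinedI[of _ c]) auto
  next
    fix \<omega> assume "hits \<omega> c (T b')"
    then obtain s where s: "s \<in> T b'" "(c, s) \<in> (link \<omega>)\<^sup>*" by (auto simp: hits_def)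
    have *: "(b', v) \<in> (link (H - X))\<^sup>*" if "v \<in> W" for v
    proof -
      have "(b', v) \<in> (link (avoiding H (T b)))\<^sup>*" using that by (simp add: W_def)
      then have "(b', v) \<in> (link (H - X))\<^sup>* \<and> v \<in> W"
      proof (induction rule: rtrancl_induct)
        case base
        then show ?case by (simp add: W_def)
      next
        case (step y z)
        have e: "{y, z} \<in> avoiding H (T b)" using step.hyps by (simp add: link_def)
        then have "z \<in> W" using W_edge step by blast
        moreover have "{y, z} \<in> H - X" using e step \<open>z \<in> W\<close> by (auto simp: X_def avoiding_def)
        ultimately show ?case using link_trans[OF _ link_edge, of b' y "H - X" z] step.IH by blast
      qed
      then show ?thesis by simp
    qed
    have disj: "v \<notin> T b" if "v \<in> T b'" for v
      using explorationD(3)[OF ex b(1,2) _ that] b(3) by blast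
    \<comment> \<open>\<open>T b'\<close> is connected by edges inside itself and is disjoint from
      \<open>T b\<close>, so it lies in \<open>W\<close>.\<close>
    have "(b', s) \<in> (link (avoiding H (T b)))\<^sup>*"
      by (rule link_rtrancl_mono_pairs[OF _ explorationD(2)[OF ex b(2) explorationD(1)[OF ex b(2)] s(1)]])
        (simp_all add: avoiding_def disj)
    then have "(b', s) \<in> (link (H - X))\<^sup>*" using * by (simp add: W_def)
    then have "(s, x) \<in> (link (H - X))\<^sup>*" if "x \<in> W" for x
      using link_trans[OF link_sym *[OF that]] by simp
    then have "(c, x) \<in> (link (\<omega> \<union> (H - X)))\<^sup>*" if "x \<in> W" for x
      using that link_trans[OF link_rtrancl_mono[OF Un_upper1 s(2)] link_rtrancl_mono[OF Un_upper2]] by simp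
    then show "joined (\<omega> \<union> (H - X)) (insert c (B - (B - W)))" by (intro joinedI[of _ c]) auto
  qed (use assms in auto)
qed

section \<open>The bound at a state of the exploration, and leaves where the terminals are
  joined\<close>

definition bound :: "real \<Rightarrow> 'a set set \<Rightarrow> 'a set set \<Rightarrow> bool" where
  "bound \<theta> U H \<longleftrightarrow> prb U (\<lambda>\<omega>. joined (\<omega> \<union> H) (insert c B))
     \<le> \<theta> * prb U (\<lambda>\<omega>. joined (\<omega> \<union> H) B) + (real (card B))\<^sup>2 * Q U H / \<theta>"

text \<open>\<open>bound\<close> is the desired inequality given that \<open>H\<close> is open and
  only \<open>U\<close> is undecided. Conditioning on \<open>e\<close> averages the two
  probabilities exactly, while \<open>Q_insert\<close> makes the \<open>Q\<close> term at least its
  average, so the inequality passes from both outcomes of \<open>e\<close> to the state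
  before.\<close>

lemma bound_insert:
  assumes "finite U" "e \<notin> U" "0 < \<theta>" "bound \<theta> U (insert e H)" "bound \<theta> U H"
  shows "bound \<theta> (insert e U) H"
proof -
  let ?p = "p e" and ?q = "1 - p e" 
  let ?P = "\<lambda>H. prb U (\<lambda>\<omega>. joined (\<omega> \<union> H) (insert c B))"
  let ?t = "\<lambda>H. prb U (\<lambda>\<omega>. joined (\<omega> \<union> H) B)"
  define k where "k = (real (card B))\<^sup>2 / \<theta>"
  have bound_iff: "bound \<theta> U H \<longleftrightarrow> prb U (\<lambda>\<omega>. joined (\<omega> \<union> H) (insert c B))
      \<le> \<theta> * prb U (\<lambda>\<omega>. joined (\<omega> \<union> H) B) + k * Q U H" for U H
    by (simp add: bound_def k_def)
  have "0 \<le> k" using assms(3) by (simp add: k_def)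
  have pq: "0 \<le> ?p" "0 \<le> ?q" using p_ge p_le by (auto simp: algebra_simps)
  have "?p * ?P (insert e H) + ?q * ?P H
      \<le> ?p * (\<theta> * ?t (insert e H) + k * Q U (insert e H)) + ?q * (\<theta> * ?t H + k * Q U H)"
    using assms(4,5) pq unfolding bound_iff by (intro add_mono mult_left_mono) auto
  also have "\<dots> = \<theta> * (?p * ?t (insert e H) + ?q * ?t H) + k * (?p * Q U (insert e H) + ?q * Q U H)"
    by (simp add: algebra_simps)
  also have "\<dots> \<le> \<theta> * (?p * ?t (insert e H) + ?q * ?t H) + k * Q (insert e U) H"
    using Q_insert[OF assms(1,2)] \<open>0 \<le> k\<close> by (intro add_left_mono mult_left_mono) auto
  finally show ?thesis using assms(1,2) by (simp add: bound_iff prb_insert)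
qed

text \<open>Up to its first contact with a territory, a path from \<open>c\<close> uses unrevealed
  edges only, since edges of \<open>H\<close> stay inside the territories. So some territory is hit;
  \<open>low\<close> bounds each hit probability and \<open>hit_mult_le_Q\<close> the products of
  two.\<close>

lemma bound_if_joined:
  assumes "finite U" "0 < \<theta>" and ex: "exploration H T" and "joined H B"
    and low: "\<And>b. b \<in> B \<Longrightarrow> hit U (T b) < \<theta>" and c: "c \<notin> (\<Union>b\<in>B. T b)"
  shows "bound \<theta> U H"
proof -
  let ?V = "\<Union>b\<in>B. T b"
  have "joined (\<omega> \<union> H) B" for \<omega> using joined_mono[OF _ _ \<open>joined H B\<close>, of "\<omega> \<union> H" B] by blast
  then have t: "prb U (\<lambda>\<omega>. joined (\<omega> \<union> H) B) = 1" using assms(1) by (intro prb_True)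
  have "prb U (\<lambda>\<omega>. joined (\<omega> \<union> H) (insert c B)) \<le> (\<Sum>b\<in>B. hit U (T b))"
    unfolding hit_def
  proof (rule prb_union_bound[OF finite_B])
    fix \<omega> assume "joined (\<omega> \<union> H) (insert c B)"
    then have "(c, r) \<in> (link (\<omega> \<union> H))\<^sup>*" using r_in by (simp add: joined_def)
    moreover have "r \<in> ?V" using explorationD(1)[OF ex] r_in by blast
    ultimately obtain u s where us: "(c, u) \<in> (link (avoiding (\<omega> \<union> H) ?V))\<^sup>*" "u \<notin> ?V"
      "{u, s} \<in> \<omega> \<union> H" "s \<in> ?V"
      using first_hit c by meson
    have "(c, u) \<in> (link \<omega>)\<^sup>*"
      by (rule link_rtrancl_mono_pairs[OF _ us(1)])
        (use explorationD(4)[OF ex] in \<open>fastforce simp: avoiding_def\<close>)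
    moreover have "{u, s} \<in> \<omega>" using us explorationD(4)[OF ex] by blast
    ultimately have "(c, s) \<in> (link \<omega>)\<^sup>*" by (rule link_trans[OF _ link_edge])
    then show "\<exists>b\<in>B. hits \<omega> c (T b)" using us(4) by (auto simp: hits_def)
  qed
  also have "\<dots> \<le> \<theta> + (real (card B))\<^sup>2 * Q U H / \<theta>"
    using assms finite_B r_in low hit_nonneg Q_nonneg hit_mult_le_Q[OF assms(1) ex \<open>joined H B\<close>]
    by (intro sum_le_of_small_products) (auto intro: less_imp_le)
  finally show ?thesis by (simp add: bound_def t)
qed

section \<open>Unrevealed edges that leave a territory\<close>

definition leaving :: "'a set set \<Rightarrow> ('a \<Rightarrow> 'a set) \<Rightarrow> 'a \<Rightarrow> 'a set set" where
  "leaving U T b = {e \<in> U. \<exists>u\<in>T b. \<exists>w. w \<notin> (\<Union>b\<in>B. T b) \<and> e = {u, w}}"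

text \<open>If \<open>hit U (T b) < \<theta> / 2\<close>, then by \<open>post\<close> the outer end \<open>w\<close> of any edge leaving \<open>T b\<close> is joined to \<open>c\<close>
  off \<open>T b\<close> with probability at least \<open>\<theta> / 2\<close>, independently of which edges leaving \<open>T b\<close> are open.\<close>

lemma leaving_le_hit:
  assumes "finite U" "0 < \<theta>" "b \<in> B"
    and post: "\<And>u w. u \<in> T b \<Longrightarrow> w \<notin> (\<Union>b\<in>B. T b) \<Longrightarrow> {u, w} \<in> U \<Longrightarrow>
      \<theta> \<le> hit (U - {{u, w}}) (insert w (T b))"
  shows "\<theta> * prb (leaving U T b) (\<lambda>\<omega>. \<omega> \<noteq> {}) \<le> 2 * hit U (T b)"
proof (cases "\<theta> \<le> 2 * hit U (T b)")
  case True
  have "finite (leaving U T b)" using assms(1) by (simp add: leaving_def)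
  then have "\<theta> * prb (leaving U T b) (\<lambda>\<omega>. \<omega> \<noteq> {}) \<le> \<theta> * 1"
    using assms(2) prb_le_1 by (intro mult_left_mono) auto
  then show ?thesis using True by simp
next
  case False
  let ?D = "leaving U T b"
  let ?off = "\<lambda>w \<omega>. (c, w) \<in> (link (avoiding \<omega> (T b)))\<^sup>*"
  have D: "?D \<subseteq> U" "finite ?D" "finite (U - ?D)" using assms(1) by (auto simp: leaving_def)
  have off_ge: "\<theta> \<le> 2 * prb (U - ?D) (?off w)" if e: "u \<in> T b" "w \<notin> (\<Union>b\<in>B. T b)" "{u, w} \<in> U" for u w
  proof -
    have "\<theta> \<le> hit (U - {{u, w}}) (insert w (T b))" by (rule post[OF e])
    also have "\<dots> \<le> hit U (insert w (T b))" using assms(1) e by (intro hit_diff_le) auto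
    \<comment> \<open>A union bound over two events indexed by a boolean: \<open>c\<close> reaches
      \<open>T b\<close>, or \<open>c\<close> reaches \<open>w\<close> by a path off
      \<open>T b\<close>.\<close>
    also have "\<dots> \<le> (\<Sum>i\<in>{True, False}. prb U (\<lambda>\<omega>. if i then hits \<omega> c (T b) else ?off w \<omega>))"
      unfolding hit_def
    proof (rule prb_union_bound)
      fix \<omega> assume "hits \<omega> c (insert w (T b))"
      then have "(c, w) \<in> (link \<omega>)\<^sup>*" if "\<not> hits \<omega> c (T b)" using that by (auto simp: hits_def)
      then have "hits \<omega> c (T b) \<or> ?off w \<omega>" using avoiding_rtrancl_if_not_hits[of c w \<omega> "T b"] by blast
      then show "\<exists>i\<in>{True, False}. if i then hits \<omega> c (T b) else ?off w \<omega>" by auto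
    qed simp
    also have "\<dots> = hit U (T b) + prb U (?off w)" by (simp add: hit_def)
    \<comment> \<open>Every edge of \<open>?D\<close> meets \<open>T b\<close>, so paths off
      \<open>T b\<close> never use one.\<close>
    also have "prb U (?off w) = prb (U - ?D) (?off w)"
    proof (rule prb_local[OF assms(1) D(1)])
      fix \<omega>
      have "avoiding \<omega> (T b) = avoiding (\<omega> - ?D) (T b)" by (auto simp: avoiding_def leaving_def)
      then show "?off w \<omega> = ?off w (\<omega> - ?D)" by simp
    qed
    finally show ?thesis using False by simp
  qed
  have "\<theta> / 2 * prb ?D (\<lambda>\<omega>. \<omega> \<noteq> {}) = expc p ?D (\<lambda>\<omega>. \<theta> / 2 * of_bool (\<omega> \<noteq> {}))"
    unfolding prb_def by (rule expc_cmult[symmetric])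
  also have "\<dots> \<le> expc p ?D (\<lambda>\<omega>. prb (U - ?D) (\<lambda>\<omega>'. hits (\<omega> \<union> \<omega>') c (T b)))"
  proof (rule expc_mono)
    fix \<omega> assume w: "\<omega> \<subseteq> ?D"
    show "\<theta> / 2 * of_bool (\<omega> \<noteq> {}) \<le> prb (U - ?D) (\<lambda>\<omega>'. hits (\<omega> \<union> \<omega>') c (T b))"
    proof (cases "\<omega> = {}")
      case True
      then show ?thesis using prb_nonneg by simp
    next
      case False
      then obtain e where "e \<in> \<omega>" "e \<in> ?D" using w by auto
      then obtain u w where e: "u \<in> T b" "w \<notin> (\<Union>b\<in>B. T b)" "{u, w} \<in> U" "{u, w} \<in> \<omega>"
        unfolding leaving_def by blast
      have "\<theta> / 2 \<le> prb (U - ?D) (?off w)" using off_ge[OF e(1-3)] by simp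
      also have "\<dots> \<le> prb (U - ?D) (\<lambda>\<omega>'. hits (\<omega> \<union> \<omega>') c (T b))"
      proof (rule prb_mono)
        fix \<omega>' assume "?off w \<omega>'"
        moreover have "avoiding \<omega>' (T b) \<subseteq> \<omega> \<union> \<omega>'" by (auto simp: avoiding_def)
        ultimately have "(c, w) \<in> (link (\<omega> \<union> \<omega>'))\<^sup>*" by (rule link_rtrancl_mono[rotated])
        moreover have "{w, u} \<in> \<omega> \<union> \<omega>'" using e(4) by (simp add: insert_commute)
        ultimately have "(c, u) \<in> (link (\<omega> \<union> \<omega>'))\<^sup>*" by (rule link_trans[OF _ link_edge])
        then show "hits (\<omega> \<union> \<omega>') c (T b)" using e(1) by (auto simp: hits_def)
      qed
      finally show ?thesis using False by simp
    qed
  qed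
  also have "\<dots> = hit U (T b)"
    unfolding hit_def prb_def using expc_split[OF D(2,3), of p] D(1) by (simp add: Un_absorb1)
  finally show ?thesis by simp
qed

section \<open>The tree of connected classes of terminals\<close>

definition cls :: "'a set set \<Rightarrow> 'a \<Rightarrow> 'a set" where
  "cls H b = {x \<in> B. (b, x) \<in> (link H)\<^sup>*}"

lemma cls_eq: "x \<in> cls H b \<Longrightarrow> cls H x = cls H b"
  using link_trans[of b x H] link_trans[OF link_sym, of b x H] by (auto simp: cls_def)

text \<open>Both ends of an edge of \<open>H\<close> lie in territories, and a territory reached
  from \<open>b\<close> has its terminal in the class of \<open>b\<close>. So a path in
  \<open>H\<close> from \<open>b\<close> cannot leave the territories of the class.\<close>

lemma cls_territory:
  assumes ex: "exploration H T" and b: "b \<in> B" and v: "(b, v) \<in> (link H)\<^sup>*"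
  shows "(b, v) \<in> (link {e \<in> H. e \<subseteq> (\<Union>x\<in>cls H b. T x)})\<^sup>* \<and> v \<in> (\<Union>x\<in>cls H b. T x)"
  using v
proof (induction rule: rtrancl_induct)
  case base
  have "b \<in> cls H b" using b by (simp add: cls_def)
  then show ?case using explorationD(1)[OF ex b] by auto
next
  case (step y z)
  let ?V = "\<Union>x\<in>cls H b. T x"
  have e: "{y, z} \<in> H" using step.hyps by (simp add: link_def)
  then have "{z, y} \<in> H" by (simp add: insert_commute)
  then obtain x where x: "x \<in> B" "z \<in> T x" using explorationD(4)[OF ex] by blast
  have "(z, x) \<in> (link H)\<^sup>*"
    by (rule link_rtrancl_mono[OF _ explorationD(2)[OF ex x explorationD(1)[OF ex x(1)]]]) auto
  then have "(b, x) \<in> (link H)\<^sup>*" by (rule link_trans[OF rtrancl_into_rtrancl[OF step.hyps]])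
  then have z: "z \<in> ?V" using x by (auto simp: cls_def)
  then have "{y, z} \<in> {e \<in> H. e \<subseteq> ?V}" using e step.IH by simp
  then show ?case using z link_trans[OF conjunct1[OF step.IH] link_edge] by blast
qed

lemma link_into_cls:
  assumes ex: "exploration H T" and "x \<in> cls H b" "v \<in> T x"
  shows "(b, v) \<in> (link H)\<^sup>*"
proof -
  have x: "x \<in> B" "(b, x) \<in> (link H)\<^sup>*" using assms(2) by (auto simp: cls_def)
  have "(x, v) \<in> (link H)\<^sup>*"
    by (rule link_rtrancl_mono[OF _ explorationD(2)[OF ex x(1) explorationD(1)[OF ex x(1)] assms(3)]]) auto
  then show ?thesis by (rule link_trans[OF x(2)])
qed

text \<open>This makes the class of \<open>b\<close> a leaf as seen from \<open>c\<close>: deleting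
  its territories cuts off no other terminal.\<close>

definition rest_joined :: "'a set set \<Rightarrow> ('a \<Rightarrow> 'a set) \<Rightarrow> 'a \<Rightarrow> 'a set set \<Rightarrow> bool" where
  "rest_joined H T b \<omega> \<longleftrightarrow>
     joined (avoiding (\<omega> \<union> H) (\<Union>x\<in>cls H b. T x)) (insert c (B - cls H b))"

text \<open>The edges of \<open>H\<close> touching the class go to the first copy. They connect the
  class, so one hit on \<open>T b\<close> joins \<open>c\<close> to all of it, and the second copy
  works off the class. Since \<open>H\<close> does not join \<open>B\<close>, the class is a proper
  subset of \<open>B\<close>.\<close>

lemma hit_mult_rest_le_Q:
  assumes "finite U" and ex: "exploration H T" and "\<not> joined H B" and b: "b \<in> B"
  shows "hit U (T b) * prb U (rest_joined H T b) \<le> Q U H"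
proof -
  let ?V = "\<Union>x\<in>cls H b. T x"
  define X where "X = {e \<in> H. e \<inter> ?V \<noteq> {}}"
  have to_X: "(b, v) \<in> (link X)\<^sup>*" if "(b, v) \<in> (link H)\<^sup>*" for v
    by (rule link_rtrancl_mono_pairs[OF _ conjunct1[OF cls_territory[OF ex b that]]]) (auto simp: X_def)
  show ?thesis unfolding hit_def
  proof (rule prb_mult_le_Q)
    show "X \<subseteq> H" by (auto simp: X_def)
    show "cls H b \<noteq> {}" using b by (auto simp: cls_def)
    have "cls H b \<noteq> B"
    proof
      assume "cls H b = B"
      then have "joined H B" by (intro joinedI[of _ b]) (auto simp: cls_def)
      then show False using assms(3) by simp
    qed
    then show "cls H b \<subset> B" by (auto simp: cls_def)
  next
    fix \<omega> assume "hits \<omega> c (T b)"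
    then obtain s where s: "s \<in> T b" "(c, s) \<in> (link \<omega>)\<^sup>*" by (auto simp: hits_def)
    have "b \<in> cls H b" using b by (simp add: cls_def)
    then have sb: "(s, b) \<in> (link X)\<^sup>*" by (intro link_sym[OF to_X] link_into_cls[OF ex _ s(1)])
    have "(c, x) \<in> (link (\<omega> \<union> X))\<^sup>*" if "x \<in> cls H b" for x
    proof -
      have "(b, x) \<in> (link X)\<^sup>*" using to_X that by (simp add: cls_def)
      from link_rtrancl_mono[OF Un_upper2 link_trans[OF sb this]]
      show ?thesis by (rule link_trans[OF link_rtrancl_mono[OF Un_upper1 s(2)]])
    qed
    then show "joined (\<omega> \<union> X) (insert c (cls H b))" by (intro joinedI[of _ c]) auto
  next
    fix \<omega> assume "rest_joined H T b \<omega>"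
    moreover have "avoiding (\<omega> \<union> H) ?V \<subseteq> \<omega> \<union> (H - X)" by (auto simp: avoiding_def X_def)
    ultimately show "joined (\<omega> \<union> (H - X)) (insert c (B - cls H b))"
      unfolding rest_joined_def by (rule joined_mono[OF _ order_refl, rotated])
  qed (use assms in auto)
qed

text \<open>The class that leaves the most terminals in the component of \<open>c\<close> when it is deleted is a leaf
  of the tree of classes: a terminal cut off by it would belong to a class that leaves more.\<close>

lemma ex_leaf_class:
  assumes ex: "exploration H T" and "joined (\<omega> \<union> H) (insert c B)" and c: "c \<notin> (\<Union>b\<in>B. T b)"
  shows "\<exists>b\<in>B. rest_joined H T b \<omega>"
proof -
  let ?\<eta> = "\<omega> \<union> H"
  let ?V = "\<lambda>b. \<Union>x\<in>cls H b. T x"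
  define R where "R b = {v. (c, v) \<in> (link (avoiding ?\<eta> (?V b)))\<^sup>*}" for b
  have R_edge: "z \<in> R b" if "y \<in> R b" "{y, z} \<in> ?\<eta>" "y \<notin> ?V b" "z \<notin> ?V b" for b y z
  proof -
    have "{y, z} \<in> avoiding ?\<eta> (?V b)" using that by (simp add: avoiding_def)
    from link_trans[OF _ link_edge[OF this], of c] show ?thesis using that(1) by (simp add: R_def)
  qed
  have cV: "c \<notin> ?V b" for b using c by (auto simp: cls_def)
  have R_V: "v \<notin> ?V b" if "v \<in> R b" for v b
    by (rule avoiding_rtrancl_notin[OF that[unfolded R_def mem_Collect_eq] cV])
  obtain b where b: "b \<in> B" and max: "\<And>b'. b' \<in> B \<Longrightarrow> card (R b' \<inter> B) \<le> card (R b \<inter> B)"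
  proof -
    have "Max ((\<lambda>b. card (R b \<inter> B)) ` B) \<in> (\<lambda>b. card (R b \<inter> B)) ` B"
      using finite_B r_in by (intro Max_in) auto
    then obtain b where "b \<in> B" "card (R b \<inter> B) = Max ((\<lambda>b. card (R b \<inter> B)) ` B)" by auto
    then show thesis using finite_B by (intro that[of b]) auto
  qed
  \<comment> \<open>If the class of \<open>b\<close> cut \<open>x\<close> off, then
    \<open>R b\<close> would miss the class of \<open>x\<close>, survive the deletion of that class,
    and be enlarged by \<open>b\<close>, against maximality.\<close>
  have "x \<in> R b" if x: "x \<in> B" "x \<notin> cls H b" for x
  proof (rule ccontr)
    assume xR: "x \<notin> R b"
    have disj: "v \<notin> ?V x" if "v \<in> ?V b" for v
    proof
      assume "v \<in> ?V x"
      then have "(x, v) \<in> (link H)\<^sup>*" using link_into_cls[OF ex] by blast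
      moreover have "(b, v) \<in> (link H)\<^sup>*" using that link_into_cls[OF ex] by blast
      ultimately have "(b, x) \<in> (link H)\<^sup>*" by (intro link_trans[OF _ link_sym[of x v]])
      then show False using x by (simp add: cls_def)
    qed
    have R_disj: "v \<notin> ?V x" if v: "v \<in> R b" for v
    proof
      assume "v \<in> ?V x"
      then have "(x, v) \<in> (link H)\<^sup>*" using link_into_cls[OF ex] by blast
      from conjunct1[OF cls_territory[OF ex x(1) this]]
      have "(x, v) \<in> (link (avoiding ?\<eta> (?V b)))\<^sup>*"
        by (rule link_rtrancl_mono_pairs[rotated]) (use disj in \<open>auto simp: avoiding_def\<close>)
      from link_trans[OF _ link_sym[OF this], of c] have "x \<in> R b" using v by (simp add: R_def)
      then show False using xR by simp
    qed
    have R_sub: "v \<in> R x" if v: "v \<in> R b" for v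
    proof -
      have "(c, v) \<in> (link (avoiding ?\<eta> (?V b)))\<^sup>*" using v by (simp add: R_def)
      then have "v \<in> R b \<and> v \<in> R x"
      proof (induction rule: rtrancl_induct)
        case base
        show ?case by (simp add: R_def)
      next
        case (step y z)
        have e: "{y, z} \<in> ?\<eta>" "y \<notin> ?V b" "z \<notin> ?V b" using step.hyps by (auto simp: link_def avoiding_def)
        then have z: "z \<in> R b" using R_edge step.IH by blast
        then have "z \<in> R x" using R_edge[of y x z] e R_disj step.IH by blast
        then show ?case using z by simp
      qed
      then show ?thesis by simp
    qed
    have b_cls: "b \<in> cls H b" using b by (simp add: cls_def)
    then have bV: "b \<in> ?V b" using explorationD(1)[OF ex b] by blast
    \<comment> \<open>The path from \<open>c\<close> enters the class of \<open>b\<close> from a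
      vertex of \<open>R b\<close>; from there \<open>b\<close> is reached inside its own class,
      hence off the class of \<open>x\<close>.\<close>
    have "(c, b) \<in> (link ?\<eta>)\<^sup>*" using assms(2) b by (simp add: joined_def)
    from first_hit[OF this bV cV] obtain u s where
      u: "(c, u) \<in> (link (avoiding ?\<eta> (?V b)))\<^sup>*" "{u, s} \<in> ?\<eta>" "s \<in> ?V b" by blast
    have uR: "u \<in> R b" using u(1) by (simp add: R_def)
    then have s: "s \<in> R x" using R_edge[of u x s] R_sub[OF uR] R_disj[OF uR] disj[OF u(3)] u(2) by blast
    have "(b, s) \<in> (link H)\<^sup>*" using u(3) link_into_cls[OF ex] by blast
    from conjunct1[OF cls_territory[OF ex b this]]
    have "(b, s) \<in> (link (avoiding ?\<eta> (?V x)))\<^sup>*"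
      by (rule link_rtrancl_mono_pairs[rotated]) (use disj in \<open>auto simp: avoiding_def\<close>)
    from link_trans[OF _ link_sym[OF this], of c] have "b \<in> R x" using s by (simp add: R_def)
    moreover have "b \<notin> R b" using R_V bV by blast
    ultimately have "R b \<inter> B \<subset> R x \<inter> B" using R_sub b by blast
    then have "card (R b \<inter> B) < card (R x \<inter> B)" using finite_B by (intro psubset_card_mono) auto
    then show False using max[OF x(1)] by simp
  qed
  then have "rest_joined H T b \<omega>"
    unfolding rest_joined_def by (intro joinedI[of _ c]) (auto simp: R_def)
  then show ?thesis using b by blast
qed

text \<open>Some class is a leaf, and \<open>c\<close> enters it by an open edge leaving one of its
  territories, independently of the rest being joined. Together \<open>leaving_le_hit\<close> and
  \<open>hit_mult_rest_le_Q\<close> give at most \<open>2 * Q U H / \<theta>\<close> per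
  terminal.\<close>

lemma bound_if_postponed:
  assumes "finite U" "0 < \<theta>" and ex: "exploration H T" and nj: "\<not> joined H B"
    and c: "c \<notin> (\<Union>b\<in>B. T b)"
    and sep: "\<And>b b' u w. b \<in> B \<Longrightarrow> b' \<in> B \<Longrightarrow> b \<noteq> b' \<Longrightarrow> u \<in> T b \<Longrightarrow> w \<in> T b' \<Longrightarrow> {u, w} \<notin> U"
    and post: "\<And>b u w. b \<in> B \<Longrightarrow> u \<in> T b \<Longrightarrow> w \<notin> (\<Union>b\<in>B. T b) \<Longrightarrow> {u, w} \<in> U \<Longrightarrow>
      \<theta> \<le> hit (U - {{u, w}}) (insert w (T b))"
  shows "bound \<theta> U H"
proof -
  let ?V = "\<lambda>b. \<Union>x\<in>cls H b. T x"
  have "prb U (\<lambda>\<omega>. joined (\<omega> \<union> H) (insert c B))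
      \<le> (\<Sum>b\<in>B. prb U (\<lambda>\<omega>. \<omega> \<inter> leaving U T b \<noteq> {} \<and> rest_joined H T b \<omega>))"
  proof (rule prb_union_bound[OF finite_B])
    fix \<omega> assume w: "\<omega> \<subseteq> U" and j: "joined (\<omega> \<union> H) (insert c B)"
    obtain b where b: "b \<in> B" "rest_joined H T b \<omega>" using ex_leaf_class[OF ex j c] by blast
    have cV: "c \<notin> ?V b" using c by (auto simp: cls_def)
    have "b \<in> cls H b" using b by (simp add: cls_def)
    then have bV: "b \<in> ?V b" using explorationD(1)[OF ex b(1)] by blast
    have "(c, b) \<in> (link (\<omega> \<union> H))\<^sup>*" using j b by (simp add: joined_def)
    from first_hit[OF this bV cV] obtain u s where
      u: "u \<notin> ?V b" "{u, s} \<in> \<omega> \<union> H" "s \<in> ?V b" by blast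
    then obtain x where x: "x \<in> cls H b" "s \<in> T x" by blast
    \<comment> \<open>Edges of \<open>H\<close> never leave a class, so the entering edge is
      unrevealed; by \<open>sep\<close> its outer end then lies in no other territory, so the edge
      leaves \<open>T x\<close>.\<close>
    have "{u, s} \<notin> H"
    proof
      assume "{u, s} \<in> H"
      then have "(s, u) \<in> (link H)\<^sup>*" by (intro link_edge) (simp add: insert_commute)
      then have "(b, u) \<in> (link H)\<^sup>*" by (rule link_trans[OF link_into_cls[OF ex x]])
      then show False using cls_territory[OF ex b(1)] u(1) by blast
    qed
    then have e: "{s, u} \<in> \<omega>" "{s, u} \<in> U" using u(2) w by (auto simp: insert_commute)
    have "u \<notin> T x'" if "x' \<in> B" for x'
      using sep[of x x' s u] that x e(2) u(1) by (auto simp: cls_def)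
    then have "{s, u} \<in> \<omega> \<inter> leaving U T x" using e x(2) by (auto simp: leaving_def)
    moreover have "rest_joined H T x \<omega>" using b(2) cls_eq[OF x(1)] by (simp add: rest_joined_def)
    ultimately show "\<exists>b\<in>B. \<omega> \<inter> leaving U T b \<noteq> {} \<and> rest_joined H T b \<omega>"
      using x(1) by (auto simp: cls_def)
  qed
  also have "\<dots> \<le> (\<Sum>b\<in>B. 2 * Q U H / \<theta>)"
  proof (rule sum_mono)
    fix b assume b: "b \<in> B"
    let ?D = "leaving U T b"
    have "b \<in> cls H b" using b by (simp add: cls_def)
    \<comment> \<open>Leaving edges meet \<open>T b\<close>, so they have no influence on
      \<open>rest_joined\<close>; hence the independence.\<close>
    then have D: "?D \<subseteq> U" "avoiding (\<omega> \<union> H) (?V b) = avoiding ((\<omega> - ?D) \<union> H) (?V b)" for \<omega>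
      by (auto simp: leaving_def avoiding_def)
    have "prb U (\<lambda>\<omega>. \<omega> \<inter> ?D \<noteq> {} \<and> rest_joined H T b \<omega>)
        = prb ?D (\<lambda>\<omega>. \<omega> \<inter> ?D \<noteq> {}) * prb U (rest_joined H T b)"
      using D(2) by (intro prb_indep[OF assms(1) D(1)]) (auto simp: rest_joined_def)
    also have "prb ?D (\<lambda>\<omega>. \<omega> \<inter> ?D \<noteq> {}) = prb ?D (\<lambda>\<omega>. \<omega> \<noteq> {})"
      by (rule prb_cong) auto
    finally have "\<theta> * prb U (\<lambda>\<omega>. \<omega> \<inter> ?D \<noteq> {} \<and> rest_joined H T b \<omega>)
        = (\<theta> * prb ?D (\<lambda>\<omega>. \<omega> \<noteq> {})) * prb U (rest_joined H T b)" by simp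
    also have "\<dots> \<le> 2 * hit U (T b) * prb U (rest_joined H T b)"
      using leaving_le_hit[OF assms(1,2) b, of T] post[OF b] prb_nonneg by (intro mult_right_mono) auto
    also have "\<dots> \<le> 2 * Q U H"
      using hit_mult_rest_le_Q[OF assms(1) ex nj b] by simp
    finally show "prb U (\<lambda>\<omega>. \<omega> \<inter> ?D \<noteq> {} \<and> rest_joined H T b \<omega>) \<le> 2 * Q U H / \<theta>"
      using assms(2) by (simp add: field_simps)
  qed
  also have "\<dots> \<le> (real (card B))\<^sup>2 * Q U H / \<theta>"
  proof -
    \<comment> \<open>With at least two terminals, the factor 2 is absorbed by a second factor
      \<open>card B\<close>.\<close>
    have "real (card B) * 2 \<le> (real (card B))\<^sup>2"
      using card_B by (auto simp: power2_eq_square intro: mult_left_mono)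
    then have "real (card B) * 2 * (Q U H / \<theta>) \<le> (real (card B))\<^sup>2 * (Q U H / \<theta>)"
      using Q_nonneg assms(2) by (intro mult_right_mono) auto
    then show ?thesis by simp
  qed
  also have "\<dots> \<le> \<theta> * prb U (\<lambda>\<omega>. joined (\<omega> \<union> H) B) + (real (card B))\<^sup>2 * Q U H / \<theta>"
    using assms(2) prb_nonneg by simp
  finally show ?thesis by (simp add: bound_def)
qed

section \<open>Induction along the exploration\<close>

lemma exploration_insert:
  assumes ex: "exploration H T" and "b \<in> B" "u \<in> T b" and w: "w \<notin> (\<Union>b\<in>B. T b)"
  shows "exploration (insert {u, w} H) (T(b := insert w (T b)))"
  unfolding exploration_def
proof (intro conjI ballI impI)
  let ?T = "T(b := insert w (T b))" and ?H = "insert {u, w} H"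
  fix x assume x: "x \<in> B"
  show "x \<in> ?T x" using explorationD(1)[OF ex x] by (cases "x = b") auto
  show "joined {e \<in> ?H. e \<subseteq> ?T x} (?T x)"
  proof (cases "x = b")
    case False
    have "joined {e \<in> H. e \<subseteq> T x} (T x)" using explorationD(2)[OF ex x] by (simp add: joined_def)
    then show ?thesis using False by (intro joined_mono[OF _ _ \<open>joined {e \<in> H. e \<subseteq> T x} (T x)\<close>]) auto
  next
    case True
    let ?H' = "{e \<in> ?H. e \<subseteq> ?T x}"
    have "(u, v) \<in> (link ?H')\<^sup>*" if "v \<in> T b" for v
      by (rule link_rtrancl_mono[OF _ explorationD(2)[OF ex assms(2,3) that]]) (use True in auto)
    moreover have "(u, w) \<in> (link ?H')\<^sup>*" using assms(3) True by (intro link_edge) auto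
    ultimately show ?thesis using True by (intro joinedI[of _ u]) auto
  qed
next
  fix x x' assume x: "x \<in> B" "x' \<in> B" "x \<noteq> x'"
  have "T x \<inter> T x' = {}" using explorationD(3)[OF ex x(1,2)] x(3) by blast
  then show "(T(b := insert w (T b))) x \<inter> (T(b := insert w (T b))) x' = {}" using w x by auto
next
  fix e assume e: "e \<in> insert {u, w} H"
  have "\<forall>e\<in>H. e \<subseteq> (\<Union>b\<in>B. T b)" using ex by (simp add: exploration_def)
  moreover have "(\<Union>b\<in>B. T b) \<subseteq> (\<Union>x\<in>B. (T(b := insert w (T b))) x)" by auto
  moreover have "{u, w} \<subseteq> (\<Union>x\<in>B. (T(b := insert w (T b))) x)" using assms(2,3) by auto
  ultimately show "e \<subseteq> (\<Union>x\<in>B. (T(b := insert w (T b))) x)" using e by blast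
qed

lemma exploration_insert_between:
  assumes ex: "exploration H T" and "b \<in> B" "u \<in> T b" "b' \<in> B" "w \<in> T b'"
  shows "exploration (insert {u, w} H) T"
proof -
  have "joined {e \<in> insert {u, w} H. e \<subseteq> T x} (T x)" if "x \<in> B" for x
    by (rule joined_mono[of "{e \<in> H. e \<subseteq> T x}" _ _ "T x"])
      (use ex that in \<open>auto simp: exploration_def\<close>)
  moreover have "{u, w} \<subseteq> (\<Union>b\<in>B. T b)" using assms by auto
  ultimately show ?thesis using ex by (simp add: exploration_def)
qed

text \<open>Induction on the number of unrevealed edges. An edge between territories, or one
  extending a territory whose hit probability then stays below \<open>\<theta>\<close>, is revealed;
  when there is none, or \<open>B\<close> is joined, a leaf is reached. Removing edges from
  \<open>U\<close> never raises a hit probability, so the threshold persists.\<close>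

lemma bound_exploration:
  assumes \<theta>: "0 < \<theta>" "\<theta> \<le> 1" and "finite U" "exploration H T" "\<And>b. b \<in> B \<Longrightarrow> hit U (T b) < \<theta>"
  shows "bound \<theta> U H"
  using assms(3-5)
proof (induction "card U" arbitrary: U H T rule: less_induct)
  case less
  note ex = \<open>exploration H T\<close> and low = less.prems(3)
  let ?V = "\<Union>b\<in>B. T b"
  \<comment> \<open>A territory containing \<open>c\<close> has hit probability 1, which is not
    below \<open>\<theta>\<close>.\<close>
  have c: "c \<notin> ?V"
  proof
    assume "c \<in> ?V"
    then obtain b where b: "b \<in> B" "c \<in> T b" by auto
    then have "hit U (T b) = 1"
      unfolding hit_def using \<open>finite U\<close> by (intro prb_True) (auto simp: hits_def)
    then show False using low[OF b(1)] \<theta> by simp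
  qed
  \<comment> \<open>\<open>T\<close> remains valid if \<open>e\<close> is closed; \<open>T'\<close>
    takes over if \<open>e\<close> is open.\<close>
  have reveal: "bound \<theta> U H"
    if e: "e \<in> U" and ex': "exploration (insert e H) T'"
      and low': "\<And>b. b \<in> B \<Longrightarrow> hit (U - {e}) (T' b) < \<theta>" for e T'
  proof -
    have f: "finite (U - {e})" "card (U - {e}) < card U"
      using card_Diff1_less[OF \<open>finite U\<close> e] \<open>finite U\<close> by simp_all
    have "hit (U - {e}) (T b) < \<theta>" if "b \<in> B" for b
      using hit_diff_le[of U "{e}" "T b"] low[OF that] e \<open>finite U\<close> by simp
    then have "bound \<theta> (U - {e}) H" using less.hyps[OF f(2,1) ex] by blast
    moreover have "bound \<theta> (U - {e}) (insert e H)" using less.hyps[OF f(2,1) ex'] low' by blast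
    ultimately have "bound \<theta> (insert e (U - {e})) H" using f \<theta> by (intro bound_insert) auto
    then show ?thesis using e by (simp add: insert_absorb)
  qed
  consider
      (joined) "joined H B"
    | (between) b b' u w where "b \<in> B" "b' \<in> B" "b \<noteq> b'" "u \<in> T b" "w \<in> T b'" "{u, w} \<in> U"
    | (grow) b u w where "b \<in> B" "u \<in> T b" "w \<notin> ?V" "{u, w} \<in> U"
        "hit (U - {{u, w}}) (insert w (T b)) < \<theta>"
    | (stuck) "\<not> joined H B"
        "\<And>b b' u w. b \<in> B \<Longrightarrow> b' \<in> B \<Longrightarrow> b \<noteq> b' \<Longrightarrow> u \<in> T b \<Longrightarrow> w \<in> T b' \<Longrightarrow> {u, w} \<notin> U"
        "\<And>b u w. b \<in> B \<Longrightarrow> u \<in> T b \<Longrightarrow> w \<notin> ?V \<Longrightarrow> {u, w} \<in> U \<Longrightarrow>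
          \<theta> \<le> hit (U - {{u, w}}) (insert w (T b))"
    by (meson not_le)
  then show ?case
  proof cases
    case joined
    then show ?thesis using bound_if_joined[OF \<open>finite U\<close> \<theta>(1) ex _ low c] by blast
  next
    case between
    have "hit (U - {{u, w}}) (T x) < \<theta>" if "x \<in> B" for x
      using hit_diff_le[of U "{{u, w}}" "T x"] low[OF that] between(6) \<open>finite U\<close> by simp
    then show ?thesis
      using reveal[OF between(6) exploration_insert_between[OF ex between(1,4,2,5)]] by blast
  next
    case grow
    have "hit (U - {{u, w}}) ((T(b := insert w (T b))) x) < \<theta>" if "x \<in> B" for x
      using hit_diff_le[of U "{{u, w}}" "T x"] low[OF that] grow(4,5) \<open>finite U\<close> by simp
    then show ?thesis using reveal[OF grow(4) exploration_insert[OF ex grow(1-3)]] by blast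
  next
    case stuck
    then show ?thesis using bound_if_postponed[OF \<open>finite U\<close> \<theta>(1) ex _ c] by blast
  qed
qed

text \<open>For \<open>\<theta> \<ge> 1\<close> monotonicity in the joined set suffices. If some
  \<open>b\<close> has hit probability at least \<open>\<theta>\<close>, the split of
  \<open>B\<close> into \<open>{b}\<close> and the rest bounds \<open>\<theta> * ?P\<close> by
  \<open>Q\<close>. Otherwise the exploration starts from singleton territories.\<close>

lemma bound_initial:
  assumes "finite U" "0 < \<theta>"
  shows "bound \<theta> U {}"
proof -
  let ?P = "prb U (\<lambda>\<omega>. joined (\<omega> \<union> {}) (insert c B))"
  have k: "0 \<le> (real (card B))\<^sup>2 * Q U {} / \<theta>" using Q_nonneg assms(2) by simp
  consider "1 \<le> \<theta>" | b where "b \<in> B" "\<theta> \<le> hit U {b}" | "\<theta> \<le> 1" "\<And>b. b \<in> B \<Longrightarrow> hit U {b} < \<theta>"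
    by (meson linear not_le)
  then show ?thesis
  proof cases
    case 1
    have "?P \<le> prb U (\<lambda>\<omega>. joined (\<omega> \<union> {}) B)"
      by (rule prb_mono) (auto intro: joined_mono[OF order_refl])
    also have "\<dots> \<le> \<theta> * \<dots>" using 1 prb_nonneg mult_right_mono[of 1 \<theta>] by fastforce
    finally show ?thesis using k by (simp add: bound_def)
  next
    case 2
    have "B \<noteq> {b}" using card_B by auto
    have "\<theta> * ?P \<le> hit U {b} * prb U (\<lambda>\<omega>. joined \<omega> (insert c (B - {b})))"
      using 2 prb_nonneg hit_nonneg by (intro mult_mono prb_mono) (auto intro: joined_mono[OF order_refl])
    also have "\<dots> \<le> Q U {}"
      unfolding hit_def
    proof (rule prb_mult_le_Q[of _ "{}"])
      show "{b} \<subset> B" using 2 \<open>B \<noteq> {b}\<close> by auto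
      show "joined (\<omega> \<union> {}) {c, b}" if "hits \<omega> c {b}" for \<omega>
        using that by (intro joinedI[of _ c]) (auto simp: hits_def)
    qed (use assms in auto)
    also have "\<dots> \<le> (real (card B))\<^sup>2 * Q U {}"
      using card_B Q_nonneg mult_right_mono[of 1 "(real (card B))\<^sup>2" "Q U {}"] by (simp add: one_le_power)
    finally have "?P \<le> (real (card B))\<^sup>2 * Q U {} / \<theta>" using assms(2) by (simp add: field_simps)
    moreover have "0 \<le> \<theta> * prb U (\<lambda>\<omega>. joined (\<omega> \<union> {}) B)" using assms(2) prb_nonneg by simp
    ultimately show ?thesis unfolding bound_def by linarith
  next
    case 3
    have "exploration {} (\<lambda>b. {b})" by (auto simp: exploration_def joined_def)
    then show ?thesis using bound_exploration[of \<theta> U "{}" "\<lambda>b. {b}"] 3 assms by blast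
  qed
qed

section \<open>The squared inequality on finitely many edges\<close>

lemma Q_le_sum:
  assumes "finite U"
  shows "Q U {} \<le> (\<Sum>S | r \<in> S \<and> S \<subset> B.
    prb U (\<lambda>\<omega>. joined \<omega> (insert c S)) * prb U (\<lambda>\<omega>. joined \<omega> (insert c (B - S))))"
proof -
  let ?I = "{S. r \<in> S \<and> S \<subset> B}"
  have I: "finite ?I" by (rule finite_subset[OF _ finite_Pow_iff[THEN iffD2, OF finite_B]]) auto
  \<comment> \<open>With \<open>H\<close> empty the copies share no edge, so a union bound over the
    splits leaves products of independent events.\<close>
  have "Q U {} \<le> expc p U (\<lambda>\<omega>. \<Sum>S\<in>?I.
      of_bool (joined \<omega> (insert c S)) * prb U (\<lambda>\<omega>'. joined \<omega>' (insert c (B - S))))"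
    unfolding Q_def
  proof (rule expc_mono)
    fix \<omega>
    have "prb U (\<lambda>\<omega>'. \<exists>X\<subseteq>{}. split_joined (\<omega> \<union> X) (\<omega>' \<union> ({} - X)))
        \<le> (\<Sum>S\<in>?I. prb U (\<lambda>\<omega>'. joined \<omega> (insert c S) \<and> joined \<omega>' (insert c (B - S))))"
      by (rule prb_union_bound[OF I]) (auto simp: split_joined_def)
    also have "\<dots> = (\<Sum>S\<in>?I. of_bool (joined \<omega> (insert c S)) * prb U (\<lambda>\<omega>'. joined \<omega>' (insert c (B - S))))"
      by (simp add: prb_def of_bool_conj expc_cmult)
    finally show "prb U (\<lambda>\<omega>'. \<exists>X\<subseteq>{}. split_joined (\<omega> \<union> X) (\<omega>' \<union> ({} - X))) \<le> \<dots>" .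
  qed
  also have "\<dots> = (\<Sum>S\<in>?I. prb U (\<lambda>\<omega>. joined \<omega> (insert c S)) * prb U (\<lambda>\<omega>. joined \<omega> (insert c (B - S))))"
    unfolding expc_sum by (simp add: expc_multc prb_def)
  finally show ?thesis .
qed

lemma prb_joined_square_le:
  assumes "finite U"
  shows "(prb U (\<lambda>\<omega>. joined \<omega> (insert c B)))\<^sup>2 \<le> 4 * (real (card B))\<^sup>2 *
    (prb U (\<lambda>\<omega>. joined \<omega> B) * (\<Sum>S | r \<in> S \<and> S \<subset> B.
      prb U (\<lambda>\<omega>. joined \<omega> (insert c S)) * prb U (\<lambda>\<omega>. joined \<omega> (insert c (B - S)))))"
proof -
  let ?P = "prb U (\<lambda>\<omega>. joined \<omega> (insert c B))" and ?t = "prb U (\<lambda>\<omega>. joined \<omega> B)"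
  let ?m = "real (card B)"
  have le: "?P \<le> \<theta> * ?t + ?m\<^sup>2 * Q U {} / \<theta>" if "0 < \<theta>" for \<theta>
    using bound_initial[OF assms that] by (simp add: bound_def)
  have P_t: "?P \<le> ?t" by (rule prb_mono) (auto intro: joined_mono[OF order_refl])
  have "?P\<^sup>2 \<le> 4 * (?t * (?m\<^sup>2 * Q U {}))"
    by (rule square_le_if_le_weighted_sum) (use le prb_nonneg P_t Q_nonneg in auto)
  also have "\<dots> = 4 * ?m\<^sup>2 * (?t * Q U {})" by simp
  also have "\<dots> \<le> 4 * ?m\<^sup>2 * (?t * (\<Sum>S | r \<in> S \<and> S \<subset> B.
      prb U (\<lambda>\<omega>. joined \<omega> (insert c S)) * prb U (\<lambda>\<omega>. joined \<omega> (insert c (B - S)))))"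
    using Q_le_sum[OF assms] prb_nonneg by (intro mult_left_mono) auto
  finally show ?thesis .
qed

end

section \<open>Passage to countable graphs\<close>

text \<open>The value 0 off \<open>E\<close> keeps \<open>edge_prob\<close> in the unit interval for
  every set, as \<open>edge_probabilities\<close> demands.\<close>

definition edge_prob :: "'a set set \<Rightarrow> ('a set \<Rightarrow> real) \<Rightarrow> real \<Rightarrow> 'a set \<Rightarrow> real" where
  "edge_prob E J \<beta> e = (if e \<in> E then 1 - exp (- \<beta> * J e) else 0)"

text \<open>An event decided by \<open>F\<close> is a finite disjoint union of cylinders, one for
  each admissible set of open edges, and the product measure of a cylinder is its weight in
  \<open>expc\<close>.\<close>

lemma bond_percolation_finite:
  fixes P :: "'a set set \<Rightarrow> bool"
  assumes "\<And>e. e \<in> E \<Longrightarrow> 0 \<le> J e" "0 \<le> \<beta>" "finite F" "F \<subseteq> E"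
  defines "M \<equiv> bond_percolation E J \<beta>"
  shows "{\<omega> \<in> space M. P {e \<in> F. \<omega> e}} \<in> sets M"
    and "measure M {\<omega> \<in> space M. P {e \<in> F. \<omega> e}} = expc (edge_prob E J \<beta>) F (\<lambda>\<omega>. of_bool (P \<omega>))"
proof -
  let ?\<mu> = "\<lambda>e. measure_pmf (bernoulli_pmf (1 - exp (- \<beta> * J e)))"
  interpret product_prob_space ?\<mu> E by unfold_locales
  have M: "M = PiM E ?\<mu>" by (simp add: M_def bond_percolation_def)
  define cyl where "cyl s = {\<omega> \<in> space M. {e \<in> F. \<omega> e} = s}" for s
  have cyl_emb: "cyl s = prod_emb E ?\<mu> F (Pi\<^sub>E F (\<lambda>e. {e \<in> s}))" if "s \<subseteq> F" for s
  proof -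
    have "{e \<in> F. \<omega> e} = s \<longleftrightarrow> (\<forall>e\<in>F. \<omega> e = (e \<in> s))" for \<omega> using that by auto
    then have "cyl s = {\<omega> \<in> space (PiM E ?\<mu>). \<forall>e\<in>F. \<omega> e = (e \<in> s)}" by (simp add: cyl_def M)
    also have "\<dots> = prod_emb E ?\<mu> F (Pi\<^sub>E F (\<lambda>e. {e \<in> s}))"
      by (rule set_eqI) (simp add: space_PiM prod_emb_iff PiE_iff)
    finally show ?thesis .
  qed
  have cyl_sets: "cyl s \<in> sets M" if "s \<subseteq> F" for s
    unfolding cyl_emb[OF that] M using assms(3,4) by (intro sets_PiM_I) auto
  have cyl_measure: "measure M (cyl s) = (\<Prod>e\<in>F. if e \<in> s then edge_prob E J \<beta> e else 1 - edge_prob E J \<beta> e)"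
    if "s \<subseteq> F" for s
  proof -
    have "measure M (cyl s) = (\<Prod>e\<in>F. measure (?\<mu> e) {e \<in> s})"
      unfolding cyl_emb[OF that] M using assms(3,4) by (intro measure_PiM_emb) auto
    also have "\<dots> = (\<Prod>e\<in>F. if e \<in> s then edge_prob E J \<beta> e else 1 - edge_prob E J \<beta> e)"
    proof (rule prod.cong[OF refl])
      fix e assume "e \<in> F"
      then have "e \<in> E" using assms(4) by auto
      then have "0 \<le> \<beta> * J e" using assms(1,2) by simp
      then show "measure (?\<mu> e) {e \<in> s} = (if e \<in> s then edge_prob E J \<beta> e else 1 - edge_prob E J \<beta> e)"
        using \<open>e \<in> E\<close> by (simp add: measure_pmf_single edge_prob_def)
    qed
    finally show ?thesis .
  qed
  let ?I = "{s \<in> Pow F. P s}"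
  have event: "{\<omega> \<in> space M. P {e \<in> F. \<omega> e}} = (\<Union>s\<in>?I. cyl s)"
    by (auto simp: cyl_def)
  show "{\<omega> \<in> space M. P {e \<in> F. \<omega> e}} \<in> sets M"
    unfolding event using cyl_sets assms(3) by (intro sets.finite_UN) auto
  have "measure M (\<Union>s\<in>?I. cyl s) = (\<Sum>s\<in>?I. measure M (cyl s))"
    unfolding M by (rule P.finite_measure_finite_Union)
      (use cyl_sets assms(3) in \<open>auto simp: disjoint_family_on_def cyl_def M\<close>)
  also have "\<dots> = (\<Sum>s\<in>?I. \<Prod>e\<in>F. if e \<in> s then edge_prob E J \<beta> e else 1 - edge_prob E J \<beta> e)"
    by (intro sum.cong refl cyl_measure) auto
  also have "\<dots> = (\<Sum>s\<in>Pow F. if P s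
      then \<Prod>e\<in>F. if e \<in> s then edge_prob E J \<beta> e else 1 - edge_prob E J \<beta> e else 0)"
    using assms(3) by (intro sum.inter_filter) auto
  also have "\<dots> = expc (edge_prob E J \<beta>) F (\<lambda>\<omega>. of_bool (P \<omega>))"
    unfolding expc_def by (intro sum.cong) auto
  finally show "measure M {\<omega> \<in> space M. P {e \<in> F. \<omega> e}} = expc (edge_prob E J \<beta>) F (\<lambda>\<omega>. of_bool (P \<omega>))"
    unfolding event .
qed

lemma ex_cluster_iff_joined:
  assumes "A \<subseteq> V" "A \<noteq> {}"
  shows "(\<exists>C\<in>clusters V E \<omega>. A \<subseteq> C) \<longleftrightarrow> joined {e \<in> E. \<omega> e} A"
proof -
  have adj: "open_adj E \<omega> = link {e \<in> E. \<omega> e}" by (auto simp: open_adj_def link_def)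
  show ?thesis
  proof
    assume "\<exists>C\<in>clusters V E \<omega>. A \<subseteq> C"
    then obtain v where "A \<subseteq> cluster V E \<omega> v" by (auto simp: clusters_def)
    then show "joined {e \<in> E. \<omega> e} A" by (intro joinedI[of _ v]) (auto simp: cluster_def adj)
  next
    assume j: "joined {e \<in> E. \<omega> e} A"
    obtain v where v: "v \<in> A" using assms(2) by auto
    then have "A \<subseteq> cluster V E \<omega> v" using j assms(1) by (auto simp: cluster_def adj joined_def)
    then show "\<exists>C\<in>clusters V E \<omega>. A \<subseteq> C" using v assms(1) by (auto simp: clusters_def)
  qed
qed

text \<open>By \<open>joined_incseq\<close> the events that \<open>A\<close> is joined within
  \<open>F n\<close> increase to the event of \<open>tau\<close>, so continuity from below
  applies.\<close>

lemma tendsto_tau: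
  assumes "\<And>e. e \<in> E \<Longrightarrow> 0 \<le> J e" "0 \<le> \<beta>" and F: "\<And>n. finite (F n)" "incseq F" "(\<Union>n. F n) = E"
    and A: "A \<subseteq> V" "finite A" "A \<noteq> {}"
  shows "(\<lambda>n. expc (edge_prob E J \<beta>) (F n) (\<lambda>\<omega>. of_bool (joined \<omega> A))) \<longlonglongrightarrow> tau V E J \<beta> A"
proof -
  let ?M = "bond_percolation E J \<beta>"
  let ?S = "\<lambda>n. {\<omega> \<in> space ?M. joined {e \<in> F n. \<omega> e} A}"
  interpret prob_space ?M
    unfolding bond_percolation_def by (intro prob_space_PiM prob_space_measure_pmf)
  have FE: "F n \<subseteq> E" for n using F(3) by auto
  have F_mono: "F m \<subseteq> F n" if "m \<le> n" for m n using F(2) that by (simp add: incseq_def)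
  have "(\<lambda>n. measure ?M (?S n)) \<longlonglongrightarrow> measure ?M (\<Union>n. ?S n)"
  proof (rule finite_Lim_measure_incseq)
    show "range ?S \<subseteq> sets ?M" using bond_percolation_finite(1)[OF assms(1,2) F(1) FE] by auto
    show "incseq ?S"
    proof (rule incseq_SucI, rule subsetI)
      fix n \<omega> assume "\<omega> \<in> ?S n"
      moreover have "{e \<in> F n. \<omega> e} \<subseteq> {e \<in> F (Suc n). \<omega> e}" using F_mono[of n "Suc n"] by auto
      ultimately show "\<omega> \<in> ?S (Suc n)" using joined_mono[OF _ order_refl] by blast
    qed
  qed
  also have "(\<Union>n. ?S n) = {\<omega> \<in> space ?M. \<exists>C\<in>clusters V E \<omega>. A \<subseteq> C}"
  proof -
    have "joined {e \<in> E. \<omega> e} A \<longleftrightarrow> (\<exists>n. joined {e \<in> F n. \<omega> e} A)" for \<omega>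
    proof
      assume j: "joined {e \<in> E. \<omega> e} A"
      have "(\<Union>n. {e \<in> F n. \<omega> e}) = {e \<in> E. \<omega> e}" using F(3) by auto
      moreover have "incseq (\<lambda>n. {e \<in> F n. \<omega> e})" using F_mono by (auto simp: incseq_def)
      ultimately show "\<exists>n. joined {e \<in> F n. \<omega> e} A" using joined_incseq[OF _ A(2)] j by simp
    next
      assume "\<exists>n. joined {e \<in> F n. \<omega> e} A"
      then obtain n where "joined {e \<in> F n. \<omega> e} A" ..
      then show "joined {e \<in> E. \<omega> e} A" by (rule joined_mono[OF _ order_refl, rotated]) (use FE in auto)
    qed
    then show ?thesis by (auto simp: ex_cluster_iff_joined[OF A(1,3)])
  qed
  also have "(\<lambda>n. measure ?M (?S n)) = (\<lambda>n. expc (edge_prob E J \<beta>) (F n) (\<lambda>\<omega>. of_bool (joined \<omega> A)))"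
    by (rule ext, rule bond_percolation_finite(2)) (use assms(1,2) F(1) FE in auto)
  finally show ?thesis by (simp only: tau_def)
qed

text \<open>Deleting \<open>r\<close> leaves exactly the proper subsets of
  \<open>B - {r}\<close>.\<close>

lemma card_proper_subsets_containing:
  assumes "finite B" "r \<in> B"
  shows "card {S. r \<in> S \<and> S \<subset> B} = 2 ^ (card B - 1) - 1"
proof -
  have "{S. r \<in> S \<and> S \<subset> B} = insert r ` (Pow (B - {r}) - {B - {r}})"
  proof (intro equalityI subsetI)
    fix S assume S: "S \<in> {S. r \<in> S \<and> S \<subset> B}"
    then have "S = insert r (S - {r})" "S - {r} \<in> Pow (B - {r}) - {B - {r}}" by auto
    then show "S \<in> insert r ` (Pow (B - {r}) - {B - {r}})" by (rule image_eqI)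
  qed (use assms in auto)
  moreover have "inj_on (insert r) (Pow (B - {r}) - {B - {r}})" by (auto simp: inj_on_def)
  ultimately show ?thesis using assms by (simp add: card_image card_Diff_singleton card_Pow)
qed

text \<open>\<open>E\<close> is countable, so it is exhausted by finite sets \<open>F n\<close>. On
  each of them \<open>prb_joined_square_le\<close> holds, and both sides are polynomials in finitely
  many convergent probabilities.\<close>

lemma tau_square_le:
  assumes wg: "weighted_graph V E J" and "0 \<le> \<beta>" "finite A" "A \<subseteq> V" and c: "c \<in> A" and r: "r \<in> A - {c}"
    and "3 \<le> card A"
  shows "(tau V E J \<beta> A)\<^sup>2 \<le> 4 * (real (card (A - {c})))\<^sup>2 * (tau V E J \<beta> (A - {c}) *
    (\<Sum>S | r \<in> S \<and> S \<subset> A - {c}. tau V E J \<beta> (insert c S) * tau V E J \<beta> (insert c (A - {c} - S))))"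
proof -
  interpret weighted_graph V E J by (rule wg)
  let ?p = "edge_prob E J \<beta>" and ?B = "A - {c}"
  have "countable E"
    by (rule countable_subset[OF _ countable_Collect_finite_subset[OF countable_V]])
      (use edges in \<open>auto intro: card_ge_0_finite\<close>)
  define F where "F n = {e \<in> E. to_nat_on E e < n}" for n
  have F: "finite (F n)" "incseq F" "(\<Union>n. F n) = E" for n
  proof -
    have "to_nat_on E ` F n \<subseteq> {..<n}" by (auto simp: F_def)
    moreover have "inj_on (to_nat_on E) (F n)"
      using inj_on_to_nat_on[OF \<open>countable E\<close>] by (rule inj_on_subset) (auto simp: F_def)
    ultimately show "finite (F n)" by (meson finite_imageD finite_lessThan finite_subset)
  qed (auto simp: F_def incseq_def)
  have lim: "(\<lambda>n. expc ?p (F n) (\<lambda>\<omega>. of_bool (joined \<omega> S))) \<longlonglongrightarrow> tau V E J \<beta> S"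
    if "S \<subseteq> A" "S \<noteq> {}" for S
    using that assms(2-4) F weights_nonneg by (intro tendsto_tau) (auto intro: finite_subset)
  interpret two_copies ?p c r ?B
    using assms weights_nonneg
    by unfold_locales (auto simp: edge_prob_def card_Diff_singleton)
  have cA: "insert c ?B = A" using c by auto
  have "?B \<noteq> {}" using r by auto
  show ?thesis
  proof (rule LIMSEQ_le)
    show "(\<lambda>n. (prb (F n) (\<lambda>\<omega>. joined \<omega> A))\<^sup>2) \<longlonglongrightarrow> (tau V E J \<beta> A)\<^sup>2"
      unfolding prb_def using c by (intro tendsto_power lim) auto
    show "(\<lambda>n. 4 * (real (card ?B))\<^sup>2 * (prb (F n) (\<lambda>\<omega>. joined \<omega> ?B) * (\<Sum>S | r \<in> S \<and> S \<subset> ?B.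
        prb (F n) (\<lambda>\<omega>. joined \<omega> (insert c S)) * prb (F n) (\<lambda>\<omega>. joined \<omega> (insert c (?B - S))))))
      \<longlonglongrightarrow> 4 * (real (card ?B))\<^sup>2 * (tau V E J \<beta> ?B *
        (\<Sum>S | r \<in> S \<and> S \<subset> ?B. tau V E J \<beta> (insert c S) * tau V E J \<beta> (insert c (?B - S))))"
      unfolding prb_def using c \<open>?B \<noteq> {}\<close>
      by (intro tendsto_mult tendsto_const tendsto_sum lim) auto
    show "\<exists>N. \<forall>n\<ge>N. (prb (F n) (\<lambda>\<omega>. joined \<omega> A))\<^sup>2 \<le> 4 * (real (card ?B))\<^sup>2 *
        (prb (F n) (\<lambda>\<omega>. joined \<omega> ?B) * (\<Sum>S | r \<in> S \<and> S \<subset> ?B.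
        prb (F n) (\<lambda>\<omega>. joined \<omega> (insert c S)) * prb (F n) (\<lambda>\<omega>. joined \<omega> (insert c (?B - S)))))"
      using prb_joined_square_le[OF F(1)] unfolding cA by blast
  qed
qed

theorem mainTheorem13:
  fixes V :: "'a set" and E :: "'a set set" and J :: "'a set \<Rightarrow> real"
    and \<beta> :: real and A :: "'a set"
  assumes "weighted_graph V E J"
    and "\<beta> \<ge> 0"
    and "finite A" and "A \<subseteq> V" and "card A \<ge> 3"
  shows "(tau V E J \<beta> A)\<^sup>2 \<le>
    4 * (real (card A) - 1)\<^sup>2 * (2 ^ (card A - 2) - 1) *
    Max {tau V E J \<beta> (A1 \<union> A2) * tau V E J \<beta> (A2 \<union> A3) * tau V E J \<beta> (A3 \<union> A1) | A1 A2 A3.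
           partition_on A {A1, A2, A3} \<and> distinct [A1, A2, A3]}"
proof -
  let ?t = "tau V E J \<beta>"
  let ?prods = "{?t (A1 \<union> A2) * ?t (A2 \<union> A3) * ?t (A3 \<union> A1) | A1 A2 A3.
    partition_on A {A1, A2, A3} \<and> distinct [A1, A2, A3]}"
  have "A \<noteq> {}" using assms(5) by auto
  then obtain c where c: "c \<in> A" by auto
  let ?B = "A - {c}"
  have card_B: "card ?B = card A - 1" using c assms(3) by simp
  then have "card ?B \<noteq> 0" using assms(5) by linarith
  then obtain r where r: "r \<in> ?B" by (metis card.empty ex_in_conv)
  let ?I = "{S. r \<in> S \<and> S \<subset> ?B}"
  \<comment> \<open>The members of \<open>?prods\<close> come from triples of subsets of the finite
    set \<open>A\<close>, so \<open>Max\<close> is a true maximum.\<close>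
  have "?prods \<subseteq> (\<lambda>(A1, A2, A3). ?t (A1 \<union> A2) * ?t (A2 \<union> A3) * ?t (A3 \<union> A1)) ` (Pow A \<times> Pow A \<times> Pow A)"
  proof
    fix y assume "y \<in> ?prods"
    then obtain A1 A2 A3 where y: "y = ?t (A1 \<union> A2) * ?t (A2 \<union> A3) * ?t (A3 \<union> A1)"
      and "partition_on A {A1, A2, A3}" by blast
    then have "(A1, A2, A3) \<in> Pow A \<times> Pow A \<times> Pow A" by (auto simp: partition_on_def)
    then show "y \<in> (\<lambda>(A1, A2, A3). ?t (A1 \<union> A2) * ?t (A2 \<union> A3) * ?t (A3 \<union> A1)) ` (Pow A \<times> Pow A \<times> Pow A)"
      using y by (intro image_eqI[of _ _ "(A1, A2, A3)"]) auto
  qed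
  then have fin: "finite ?prods" by (rule finite_subset) (use assms(3) in auto)
  \<comment> \<open>The partition is \<open>{S, ?B - S, {c}}\<close>: its pairwise unions are the
    three sets in the product.\<close>
  have le_Max: "?t ?B * (?t (insert c S) * ?t (insert c (?B - S))) \<le> Max ?prods" if S: "S \<in> ?I" for S
  proof (rule Max_ge[OF fin])
    have "S \<union> (?B - S) = ?B" "(?B - S) \<union> {c} = insert c (?B - S)" "{c} \<union> S = insert c S"
      using S by auto
    then have "?t ?B * (?t (insert c S) * ?t (insert c (?B - S)))
        = ?t (S \<union> (?B - S)) * ?t ((?B - S) \<union> {c}) * ?t ({c} \<union> S)" by simp
    moreover have "partition_on A {S, ?B - S, {c}}"
      using S c by (auto simp: partition_on_def disjoint_def)
    moreover have "distinct [S, ?B - S, {c}]" using S by auto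
    ultimately show "?t ?B * (?t (insert c S) * ?t (insert c (?B - S))) \<in> ?prods" by blast
  qed
  have "(?t A)\<^sup>2 \<le> 4 * (real (card ?B))\<^sup>2 *
      (?t ?B * (\<Sum>S\<in>?I. ?t (insert c S) * ?t (insert c (?B - S))))"
    using tau_square_le[OF assms(1-4) c r assms(5)] .
  also have "\<dots> = 4 * (real (card ?B))\<^sup>2 * (\<Sum>S\<in>?I. ?t ?B * (?t (insert c S) * ?t (insert c (?B - S))))"
    by (simp add: sum_distrib_left)
  also have "\<dots> \<le> 4 * (real (card ?B))\<^sup>2 * (real (card ?I) * Max ?prods)"
    using le_Max by (intro mult_left_mono sum_bounded_above) auto
  \<comment> \<open>\<open>card A - 2\<close> equals \<open>card ?B - 1\<close>, and since the power
    of 2 is at least 1, subtraction on the naturals agrees with that on the reals.\<close>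
  also have "real (card ?I) = 2 ^ (card A - 2) - 1"
    using card_proper_subsets_containing[OF _ r] assms(3) card_B by (simp add: of_nat_diff numeral_2_eq_2)
  also have "real (card ?B) = real (card A) - 1" using card_B assms(5) by simp
  finally show ?thesis by (simp add: mult.assoc)
qed

end
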